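(* Let $E$ and $F$ be locally convex spaces, and let $U$ be an open subset of $E$. Assume that for every $n\geq 1$, the $c^{\infty}$-topology on $E^n$ is the same as the product topology for the given topology on $E$, and that $F$ is Mackey-complete. Let $\Phi:U\longrightarrow F$ be a continuous map. Then the following are equivalent: (i) $\Phi$ is smooth. (ii) For every open subset $V$ of $F$ containing $\Phi(U)$ and every $f\in\mathcal{C}^{\infty}(V,\mathbb{R})$, we have $f\circ\Phi\in\mathcal{C}^{\infty}(U,\mathbb{R})$. (iii) For every $f\in\mathcal{C}^{\infty}(F,\mathbb{R})$, we have $f\circ\Phi\in\mathcal{C}^{\infty}(U,\mathbb{R})$ (i.e. $\Phi$ is scalarwise smooth). (iv) For every $\ell\in F'$, we have $\ell\circ\Phi\in\mathcal{C}^{\infty}(U,\mathbb{R})$ (i.e. $\Phi$ is weakly smooth).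
   Context: Locally convex spaces are real and Hausdorff; $F'$ is the continuous dual of $F$. Smoothness: for $E,F$ locally convex, $U\subset E$ open and $\Phi:U\to F$ continuous, put $d\Phi_{|x}(v)=\lim_{t\to 0}\frac{\Phi(x+tv)-\Phi(x)}{t}$ (when the limit exists), for $x\in U$, $v\in E$. $\Phi$ is of class $\mathcal{C}^1$ if $d\Phi:U\times E\to F$, $(x,v)\mapsto d\Phi_{|x}(v)$ exists everywhere and is continuous. Inductively, $\Phi$ is of class $\mathcal{C}^{k+1}$ if it is of class $\mathcal{C}^1$ and $d\Phi$ is of class $\mathcal{C}^k$ (on the open subset $U\times E$ of $E\times E$). $\Phi$ is smooth (of class $\mathcal{C}^\infty$) if it is $\mathcal{C}^k$ for all $k$. $\mathcal{C}^\infty(U,V)$ denotes the set of smooth maps from $U$ to $V$. The $c^\infty$-topology on a locally convex space $E$ is the finest topology on $E$ making all smooth curves $c:\mathbb{R}\to E$ (smooth with respect to the given locally convex topology) continuous. Mackey-completeness: a net $(x_i)$ in a locally convex space $F$ is Mackey-Cauchy if there exist an absolutely convex bounded set $B\subset F$ and a double net $(\mu_{i,j})$ of real numbers converging to $0$ such that $x_i-x_j\in\mu_{i,j}B$ for all $i,j$. $F$ is Mackey-complete if every Mackey-Cauchy net in $F$ converges. *)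

theory Defs
  imports "HOL-Analysis.Analysis" "HOL-Library.Function_Algebras"
begin

section \<open>Locally convex spaces\<close>

class locally_convex_space = real_vector + topological_ab_group_add + t2_space +
  assumes tendsto_scaleR_nhds:
      "((\<lambda>p. fst p *\<^sub>R snd p) \<longlongrightarrow> a *\<^sub>R x) (nhds a \<times>\<^sub>F nhds x)"
    and locally_convex:
      "open N \<Longrightarrow> 0 \<in> N \<Longrightarrow> \<exists>C. open C \<and> 0 \<in> C \<and> C \<subseteq> N \<and>
        (\<forall>x\<in>C. \<forall>y\<in>C. \<forall>u\<ge>0. \<forall>v\<ge>0. u + v = 1 \<longrightarrow> u *\<^sub>R x + v *\<^sub>R y \<in> C)"

lemma locally_convex_convex:
  fixes N :: "'a::locally_convex_space set"
  assumes "open N" "0 \<in> N"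
  shows "\<exists>C. convex C \<and> open C \<and> 0 \<in> C \<and> C \<subseteq> N"
  using locally_convex[OF assms] unfolding convex_def by blast

lemma tendsto_scaleR_lcs:
  fixes x :: "'a::locally_convex_space"
  assumes "(f \<longlongrightarrow> a) F" "(g \<longlongrightarrow> x) F"
  shows "((\<lambda>t. f t *\<^sub>R g t) \<longlongrightarrow> a *\<^sub>R x) F"
  using filterlim_compose[OF tendsto_scaleR_nhds, of "\<lambda>t. (f t, g t)" a x F] assms
  by (simp add: nhds_prod[symmetric] tendsto_Pair)

instance real_normed_vector \<subseteq> locally_convex_space
proof
  fix a :: real and x :: 'a
  show "((\<lambda>p. fst p *\<^sub>R snd p) \<longlongrightarrow> a *\<^sub>R x) (nhds a \<times>\<^sub>F nhds x)"
    unfolding nhds_prod[symmetric]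
    by (intro tendsto_scaleR tendsto_fst[where a="(a,x)", simplified] tendsto_snd[where a="(a,x)", simplified])
       (auto simp: filterlim_ident)
next
  fix N :: "'a set" assume "open N" "0 \<in> N"
  then obtain e where "e > 0" "ball 0 e \<subseteq> N" by (auto simp: open_contains_ball)
  then show "\<exists>C. open C \<and> 0 \<in> C \<and> C \<subseteq> N \<and>
      (\<forall>x\<in>C. \<forall>y\<in>C. \<forall>u\<ge>0. \<forall>v\<ge>0. u + v = 1 \<longrightarrow> u *\<^sub>R x + v *\<^sub>R y \<in> C)"
    using convex_ball[of "0::'a" e] unfolding convex_def by (intro exI[of _ "ball 0 e"]) auto
qed

instance prod :: (topological_monoid_add, topological_monoid_add) topological_monoid_add
proof
  fix a b :: "'a \<times> 'b"
  have "((\<lambda>p. fst p + snd p) \<longlongrightarrow> a + b) (nhds (a, b))"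
    unfolding plus_prod_def
    by (intro tendsto_Pair tendsto_add tendsto_fst tendsto_snd)
       (auto intro!: tendsto_fst[where a="(a,b)", simplified] tendsto_snd[where a="(a,b)", simplified] filterlim_ident)
  then show "((\<lambda>p. fst p + snd p) \<longlongrightarrow> a + b) (nhds a \<times>\<^sub>F nhds b)"
    by (simp add: nhds_prod)
qed

instance prod :: (topological_comm_monoid_add, topological_comm_monoid_add) topological_comm_monoid_add ..

instance prod :: (topological_group_add, topological_group_add) topological_group_add
proof
  fix a :: "'a \<times> 'b"
  show "(uminus \<longlongrightarrow> - a) (nhds a)"
    unfolding uminus_prod_def
    by (intro tendsto_Pair tendsto_minus tendsto_fst tendsto_snd filterlim_ident)
qed

instance prod :: (topological_ab_group_add, topological_ab_group_add) topological_ab_group_add ..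

instance prod :: (locally_convex_space, locally_convex_space) locally_convex_space
proof
  fix r :: real and x :: "'a \<times> 'b"
  have *: "((\<lambda>p. fst p *\<^sub>R snd p) \<longlongrightarrow> r *\<^sub>R x) (nhds (r, x))"
    unfolding scaleR_prod_def
    by (intro tendsto_Pair tendsto_scaleR_lcs tendsto_fst tendsto_snd)
       (auto intro!: tendsto_fst[where a="(r,x)", simplified] tendsto_snd[where a="(r,x)", simplified] filterlim_ident)
  then show "((\<lambda>p. fst p *\<^sub>R snd p) \<longlongrightarrow> r *\<^sub>R x) (nhds r \<times>\<^sub>F nhds x)"
    by (simp add: nhds_prod)
next
  fix N :: "('a \<times> 'b) set" assume "open N" "0 \<in> N"
  then obtain A B where AB: "open A" "open B" "0 \<in> A" "0 \<in> B" "A \<times> B \<subseteq> N"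
    by (auto simp: zero_prod_def elim!: open_prod_elim)
  obtain C where C: "convex C" "open C" "0 \<in> C" "C \<subseteq> A"
    using locally_convex_convex AB by metis
  obtain D where D: "convex D" "open D" "0 \<in> D" "D \<subseteq> B"
    using locally_convex_convex AB by metis
  have "convex (C \<times> D)" "open (C \<times> D)" "0 \<in> C \<times> D" "C \<times> D \<subseteq> N"
    using C D AB(5) by (simp_all add: convex_Times open_Times zero_prod_def subset_trans[OF Sigma_mono])
  then show "\<exists>C. open C \<and> 0 \<in> C \<and> C \<subseteq> N \<and>
      (\<forall>x\<in>C. \<forall>y\<in>C. \<forall>u\<ge>0. \<forall>v\<ge>0. u + v = 1 \<longrightarrow> u *\<^sub>R x + v *\<^sub>R y \<in> C)"
    unfolding convex_def by (intro exI conjI)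
qed

text \<open>The topology on functions is the product topology (\<open>open_fun_def\<close>), so that
  \<open>nat \<Rightarrow> 'a\<close> is the product of countably many copies of \<open>'a\<close>; with pointwise operations it
  is again locally convex.\<close>

instantiation "fun" :: (type, real_vector) real_vector
begin

definition scaleR_fun :: "real \<Rightarrow> ('a \<Rightarrow> 'b) \<Rightarrow> 'a \<Rightarrow> 'b"
  where "scaleR_fun r f = (\<lambda>i. r *\<^sub>R f i)"

instance
  by standard (auto simp: scaleR_fun_def fun_eq_iff algebra_simps)

end

lemma scaleR_fun_apply [simp]: "(r *\<^sub>R f) i = r *\<^sub>R f i"
  by (simp add: scaleR_fun_def)

lemma tendsto_fun_iff:
  fixes f :: "'c \<Rightarrow> 'i \<Rightarrow> 'a::topological_space"
  shows "(f \<longlongrightarrow> l) F \<longleftrightarrow> (\<forall>i. ((\<lambda>x. f x i) \<longlongrightarrow> l i) F)"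
  using limitin_componentwise[of "\<lambda>_. euclidean :: 'a topology" UNIV f l F]
  by (simp add: euclidean_product_topology)

lemma open_vimage_coordinate:
  assumes "open (S :: 'b::topological_space set)"
  shows "open {f :: 'a \<Rightarrow> 'b. f i \<in> S}"
  using open_vimage[OF assms continuous_on_product_coordinates[of i]] by (simp add: vimage_def)

instance "fun" :: (type, t0_space) t0_space
proof
  fix f g :: "'a \<Rightarrow> 'b" assume "f \<noteq> g"
  then obtain i where i: "f i \<noteq> g i" by auto
  then obtain U where U: "open U" "\<not> (f i \<in> U \<longleftrightarrow> g i \<in> U)"
    using i separation_t0[of "f i" "g i"] by blast
  show "\<exists>U. open U \<and> \<not> (f \<in> U \<longleftrightarrow> g \<in> U)"
    using U open_vimage_coordinate[of U i] by (intro exI[of _ "{h. h i \<in> U}"]) auto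
qed

instance "fun" :: (type, t1_space) t1_space
proof
  fix f g :: "'a \<Rightarrow> 'b" assume "f \<noteq> g"
  then obtain i where i: "f i \<noteq> g i" by auto
  then obtain U where U: "open U" "f i \<in> U" "g i \<notin> U"
    using i separation_t1[of "f i" "g i"] by blast
  show "\<exists>U. open U \<and> f \<in> U \<and> g \<notin> U"
    using U open_vimage_coordinate[of U i] by (intro exI[of _ "{h. h i \<in> U}"]) auto
qed

instance "fun" :: (type, t2_space) t2_space
proof
  fix f g :: "'a \<Rightarrow> 'b" assume "f \<noteq> g"
  then obtain i where i: "f i \<noteq> g i" by auto
  then obtain U V where UV: "open U" "open V" "f i \<in> U" "g i \<in> V" "U \<inter> V = {}"
    using hausdorff[OF i] by blast
  show "\<exists>U V. open U \<and> open V \<and> f \<in> U \<and> g \<in> V \<and> U \<inter> V = {}"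
    using UV open_vimage_coordinate[of U i] open_vimage_coordinate[of V i]
    by (intro exI[of _ "{h. h i \<in> U}"] exI[of _ "{h. h i \<in> V}"]) auto
qed

instance "fun" :: (type, locally_convex_space) locally_convex_space
proof
  fix a b :: "'a \<Rightarrow> 'b"
  have fst': "((\<lambda>p. fst p i) \<longlongrightarrow> fst c i) (nhds c)"
    and snd': "((\<lambda>p. snd p i) \<longlongrightarrow> snd c i) (nhds c)" for c :: "('a \<Rightarrow> 'b) \<times> ('a \<Rightarrow> 'b)" and i
    using tendsto_fst[OF filterlim_ident[of "nhds c"]] tendsto_snd[OF filterlim_ident[of "nhds c"]]
    by (auto simp: tendsto_fun_iff)
  have *: "((\<lambda>p. fst p + snd p) \<longlongrightarrow> a + b) (nhds (a, b))"
    unfolding tendsto_fun_iff using tendsto_add[OF fst'[of _ "(a, b)"] snd'[of _ "(a, b)"]] by simp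
  then show "((\<lambda>p. fst p + snd p) \<longlongrightarrow> a + b) (nhds a \<times>\<^sub>F nhds b)"
    by (simp add: nhds_prod)
  have "((\<lambda>f::'a \<Rightarrow> 'b. f i) \<longlongrightarrow> a i) (nhds a)" for i
    using filterlim_ident[of "nhds a"] by (simp add: tendsto_fun_iff)
  then show "(uminus \<longlongrightarrow> - a) (nhds a)"
    unfolding tendsto_fun_iff by (simp add: tendsto_minus)
next
  fix r :: real and x :: "'a \<Rightarrow> 'b"
  have snd': "((\<lambda>p. snd p i) \<longlongrightarrow> x i) (nhds (r, x))" for i
    using tendsto_snd[OF filterlim_ident[of "nhds (r, x)"]] by (auto simp: tendsto_fun_iff)
  have fst': "(fst \<longlongrightarrow> r) (nhds (r, x))"
    using tendsto_fst[OF filterlim_ident[of "nhds (r, x)"]] by simp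
  have "((\<lambda>p. fst p *\<^sub>R snd p) \<longlongrightarrow> r *\<^sub>R x) (nhds (r, x))"
    unfolding tendsto_fun_iff using tendsto_scaleR_lcs[OF fst' snd'] by simp
  then show "((\<lambda>p. fst p *\<^sub>R snd p) \<longlongrightarrow> r *\<^sub>R x) (nhds r \<times>\<^sub>F nhds x)"
    by (simp add: nhds_prod)
next
  fix N :: "('a \<Rightarrow> 'b) set" assume "open N" "0 \<in> N"
  then obtain X where X: "0 \<in> Pi\<^sub>E UNIV X" "\<And>i. open (X i)" "finite {i. X i \<noteq> UNIV}" "Pi\<^sub>E UNIV X \<subseteq> N"
    unfolding open_fun_def using product_topology_open_contains_basis[of "\<lambda>_. euclidean" UNIV N 0]
    by auto
  have "\<exists>C. convex C \<and> open C \<and> 0 \<in> C \<and> C \<subseteq> X i \<and> (X i = UNIV \<longrightarrow> C = UNIV)" for i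
  proof (cases "X i = UNIV")
    case False
    have "0 \<in> X i" using X(1) by (auto simp: PiE_iff)
    with False X(2)[of i] locally_convex_convex[of "X i"] show ?thesis by blast
  qed auto
  then obtain C where C: "\<And>i. convex (C i)" "\<And>i. open (C i)" "\<And>i. 0 \<in> C i" "\<And>i. C i \<subseteq> X i"
      "\<And>i. X i = UNIV \<Longrightarrow> C i = UNIV"
    by metis
  have "finite {i. C i \<noteq> UNIV}"
    by (rule finite_subset[OF _ X(3)]) (use C(5) in auto)
  then have "open (Pi\<^sub>E UNIV C)"
    using C(2) by (intro open_PiE) auto
  moreover have "0 \<in> Pi\<^sub>E UNIV C"
    using C(3) by (simp add: PiE_iff)
  moreover have "Pi\<^sub>E UNIV C \<subseteq> N"
    by (rule subset_trans[OF PiE_mono X(4)]) (rule C(4))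
  moreover have "\<forall>x\<in>Pi\<^sub>E UNIV C. \<forall>y\<in>Pi\<^sub>E UNIV C. \<forall>u\<ge>0. \<forall>v\<ge>0. u + v = 1 \<longrightarrow> u *\<^sub>R x + v *\<^sub>R y \<in> Pi\<^sub>E UNIV C"
    using C(1) by (auto simp: PiE_iff convex_def)
  ultimately show "\<exists>C. open C \<and> 0 \<in> C \<and> C \<subseteq> N \<and>
      (\<forall>x\<in>C. \<forall>y\<in>C. \<forall>u\<ge>0. \<forall>v\<ge>0. u + v = 1 \<longrightarrow> u *\<^sub>R x + v *\<^sub>R y \<in> C)"
    by blast
qed


section \<open>Finite powers of a space\<close>

text \<open>\<open>E\<^sup>n\<close> has to be available for a variable exponent \<open>n\<close>, so it is realised as the subspace
  of those sequences that vanish from index \<open>n\<close> on. The lemma below shows that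
  the subspace topology is the usual product topology.\<close>

definition power_space :: "nat \<Rightarrow> (nat \<Rightarrow> 'a::zero) set"
  where "power_space n = {x. \<forall>i\<ge>n. x i = 0}"

lemma homeomorphic_map_power_space:
  "homeomorphic_map (top_of_set (power_space n :: (nat \<Rightarrow> 'a::{zero,topological_space}) set))
     (product_topology (\<lambda>_. euclidean) {..<n}) (\<lambda>x. restrict x {..<n})"
proof (rule homeomorphic_maps_imp_map)
  let ?g = "\<lambda>x i. if i < n then x i else (0::'a)"
  have 1: "continuous_map (top_of_set (power_space n)) (product_topology (\<lambda>_. euclidean) {..<n})
      (\<lambda>x::nat \<Rightarrow> 'a. restrict x {..<n})"
    unfolding continuous_map_componentwise
    by (auto simp: continuous_map_iff_continuous intro: continuous_on_subset[OF continuous_on_product_coordinates])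
  have "continuous_map (product_topology (\<lambda>_. euclidean) {..<n}) (product_topology (\<lambda>_. euclidean) UNIV) ?g"
    unfolding continuous_map_componentwise_UNIV
  proof
    fix i
    show "continuous_map (product_topology (\<lambda>_. euclidean) {..<n}) euclidean (\<lambda>x. ?g x i)"
      by (cases "i < n") (auto intro: continuous_map_product_projection)
  qed
  then have 2: "continuous_map (product_topology (\<lambda>_. euclidean) {..<n}) (top_of_set (power_space n)) ?g"
    by (auto simp: continuous_map_in_subtopology euclidean_product_topology power_space_def)
  show "homeomorphic_maps (top_of_set (power_space n)) (product_topology (\<lambda>_. euclidean) {..<n})
      (\<lambda>x. restrict x {..<n}) ?g"
    unfolding homeomorphic_maps_def
    by (intro conjI 1 2) (auto simp: power_space_def fun_eq_iff PiE_iff extensional_def)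
qed

lemma closed_power_space: "closed (power_space n :: (nat \<Rightarrow> 'a::{zero,t1_space}) set)"
proof -
  have "closed {x :: nat \<Rightarrow> 'a. x i = 0}" for i
    using closed_vimage[OF closed_singleton continuous_on_product_coordinates[of i], of "0::'a"]
    by (simp add: vimage_def)
  moreover have "power_space n = (\<Inter>i\<in>{n..}. {x :: nat \<Rightarrow> 'a. x i = 0})"
    by (auto simp: power_space_def)
  ultimately show ?thesis by auto
qed

section \<open>Smooth maps\<close>

definition has_dir_deriv ::
    "('a::real_vector \<Rightarrow> 'b::{real_vector,topological_space}) \<Rightarrow> 'b \<Rightarrow> 'a \<Rightarrow> 'a \<Rightarrow> bool"
  where "has_dir_deriv \<Phi> l x v \<longleftrightarrow> ((\<lambda>t::real. (\<Phi> (x + t *\<^sub>R v) - \<Phi> x) /\<^sub>R t) \<longlongrightarrow> l) (at 0)"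

definition dir_deriv :: "('a::real_vector \<Rightarrow> 'b::{real_vector,topological_space}) \<Rightarrow> 'a \<Rightarrow> 'a \<Rightarrow> 'b"
  where "dir_deriv \<Phi> x v = (THE l. has_dir_deriv \<Phi> l x v)"

definition C1_on :: "'a::{real_vector,topological_space} set
    \<Rightarrow> ('a \<Rightarrow> 'b::{real_vector,topological_space}) \<Rightarrow> bool"
  where "C1_on U \<Phi> \<longleftrightarrow> continuous_on U \<Phi> \<and> (\<forall>x\<in>U. \<forall>v. \<exists>l. has_dir_deriv \<Phi> l x v) \<and>
     continuous_on (U \<times> UNIV) (\<lambda>(x, v). dir_deriv \<Phi> x v)"

text \<open>The definition of \<open>C\<^sup>k\<close> maps is a recursion that replaces \<open>E\<close> by \<open>E \<times> E\<close>, hence would change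
  the type. It is therefore carried out on the spaces \<open>E\<^sup>m\<close>, with \<open>E\<^sup>m \<times> E\<^sup>m\<close> identified with
  \<open>E\<^sup>2\<^sup>m\<close> by concatenation: \<open>z \<in> E\<^sup>2\<^sup>m\<close> corresponds to the pair \<open>(fst_half m z, snd_half m z)\<close>. The
  theorems \<open>Ck_on_0\<close> and \<open>Ck_on_Suc\<close> below establish the recursion in its original form.\<close>

definition fst_half :: "nat \<Rightarrow> (nat \<Rightarrow> 'a::zero) \<Rightarrow> nat \<Rightarrow> 'a"
  where "fst_half m z = (\<lambda>i. if i < m then z i else 0)"

definition snd_half :: "nat \<Rightarrow> (nat \<Rightarrow> 'a) \<Rightarrow> nat \<Rightarrow> 'a"
  where "snd_half m z = (\<lambda>i. z (m + i))"

definition tangent_dom :: "nat \<Rightarrow> (nat \<Rightarrow> 'a::zero) set \<Rightarrow> (nat \<Rightarrow> 'a) set"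
  where "tangent_dom m W = {z \<in> power_space (2 * m). fst_half m z \<in> W}"

definition tangent_map :: "nat \<Rightarrow> ((nat \<Rightarrow> 'a::real_vector) \<Rightarrow> 'b::{real_vector,topological_space})
    \<Rightarrow> (nat \<Rightarrow> 'a) \<Rightarrow> 'b"
  where "tangent_map m \<Phi> z = dir_deriv \<Phi> (fst_half m z) (snd_half m z)"

primrec Ck_power :: "nat \<Rightarrow> nat \<Rightarrow> (nat \<Rightarrow> 'a::{real_vector,topological_space}) set
    \<Rightarrow> ((nat \<Rightarrow> 'a) \<Rightarrow> 'b::{real_vector,topological_space}) \<Rightarrow> bool"
  where
    "Ck_power 0 m W \<Phi> \<longleftrightarrow> continuous_on W \<Phi>"
  | "Ck_power (Suc k) m W \<Phi> \<longleftrightarrow>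
       continuous_on W \<Phi> \<and> (\<forall>x\<in>W. \<forall>v\<in>power_space m. \<exists>l. has_dir_deriv \<Phi> l x v) \<and>
       continuous_on (tangent_dom m W) (tangent_map m \<Phi>) \<and>
       Ck_power k (2 * m) (tangent_dom m W) (tangent_map m \<Phi>)"

definition Ck_on :: "nat \<Rightarrow> 'a::{real_vector,topological_space} set
    \<Rightarrow> ('a \<Rightarrow> 'b::{real_vector,topological_space}) \<Rightarrow> bool"
  where "Ck_on k U \<Phi> \<longleftrightarrow> Ck_power k 1 {x \<in> power_space 1. x 0 \<in> U} (\<lambda>x. \<Phi> (x 0))"

definition smooth_on :: "'a::{real_vector,topological_space} set
    \<Rightarrow> ('a \<Rightarrow> 'b::{real_vector,topological_space}) \<Rightarrow> bool"
  where "smooth_on U \<Phi> \<longleftrightarrow> (\<forall>k. Ck_on k U \<Phi>)"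

lemma has_dir_deriv_unique:
  fixes \<Phi> :: "'a::real_vector \<Rightarrow> 'b::{real_vector,t2_space}"
  assumes "has_dir_deriv \<Phi> l x v" "has_dir_deriv \<Phi> l' x v"
  shows "l = l'"
  using assms unfolding has_dir_deriv_def by (intro tendsto_unique[of "at (0::real)"]) auto

lemma dir_deriv_eq:
  fixes \<Phi> :: "'a::real_vector \<Rightarrow> 'b::{real_vector,t2_space}"
  assumes "has_dir_deriv \<Phi> l x v"
  shows "dir_deriv \<Phi> x v = l"
  unfolding dir_deriv_def using assms has_dir_deriv_unique by blast

lemma has_dir_deriv_cong:
  assumes "\<And>t. \<Phi> (x + t *\<^sub>R v) = \<Psi> (y + t *\<^sub>R w)"
  shows "has_dir_deriv \<Phi> l x v \<longleftrightarrow> has_dir_deriv \<Psi> l y w"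
  using assms assms[of 0] by (simp add: has_dir_deriv_def)

lemma dir_deriv_cong:
  assumes "\<And>t. \<Phi> (x + t *\<^sub>R v) = \<Psi> (y + t *\<^sub>R w)"
  shows "dir_deriv \<Phi> x v = dir_deriv \<Psi> y w"
  using has_dir_deriv_cong[of \<Phi> x v \<Psi> y w] assms by (simp add: dir_deriv_def)

lemma continuous_on_coord:
  fixes f :: "'c::topological_space \<Rightarrow> 'i \<Rightarrow> 'a::topological_space"
  assumes "continuous_on S f"
  shows "continuous_on S (\<lambda>x. f x i)"
  by (rule continuous_on_product_then_coordinatewise[OF assms])

lemma continuous_on_comp_iff:
  assumes "continuous_on T h" "continuous_on S g" "h ` T \<subseteq> S" "g ` S \<subseteq> T"
    "\<And>x. x \<in> S \<Longrightarrow> h (g x) = x"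
  shows "continuous_on T (\<lambda>y. f (h y)) \<longleftrightarrow> continuous_on S f"
proof
  assume "continuous_on T (\<lambda>y. f (h y))"
  then have "continuous_on S (\<lambda>x. f (h (g x)))"
    using assms by (intro continuous_on_compose2[of T "\<lambda>y. f (h y)" S g]) auto
  then show "continuous_on S f" using assms(5) by (simp cong: continuous_on_cong)
next
  assume "continuous_on S f"
  then show "continuous_on T (\<lambda>y. f (h y))"
    using assms by (intro continuous_on_compose2[of S f T h]) auto
qed

definition pair_seq :: "(nat \<Rightarrow> 'a) \<Rightarrow> nat \<Rightarrow> 'a \<times> 'a"
  where "pair_seq x = (\<lambda>i. (x (2 * i), x (2 * i + 1)))"

definition unpair_seq :: "(nat \<Rightarrow> 'a \<times> 'a) \<Rightarrow> nat \<Rightarrow> 'a"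
  where "unpair_seq y = (\<lambda>i. if even i then fst (y (i div 2)) else snd (y (i div 2)))"

lemma pair_unpair [simp]: "pair_seq (unpair_seq y) = y"
  by (simp add: pair_seq_def unpair_seq_def)

lemma unpair_pair [simp]: "unpair_seq (pair_seq x) = x"
  by (rule ext) (simp add: pair_seq_def unpair_seq_def)

lemma pair_seq_line: "pair_seq (x + t *\<^sub>R v) = pair_seq x + t *\<^sub>R pair_seq v"
  by (simp add: pair_seq_def fun_eq_iff)

lemma pair_seq_power_space: "pair_seq x \<in> power_space m \<longleftrightarrow> x \<in> power_space (2 * m)"
proof
  assume *: "pair_seq x \<in> power_space m"
  have "x i = 0" if "i \<ge> 2 * m" for i
  proof -
    have "i div 2 \<ge> m" using that by linarith
    then have "pair_seq x (i div 2) = 0" using * by (simp add: power_space_def)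
    then show ?thesis by (cases "even i") (simp_all add: pair_seq_def zero_prod_def)
  qed
  then show "x \<in> power_space (2 * m)" by (simp add: power_space_def)
qed (simp add: power_space_def pair_seq_def zero_prod_def)

lemma fst_half_pair_seq: "fst_half m (pair_seq x) = pair_seq (fst_half (2 * m) x)"
  by (auto simp: fst_half_def pair_seq_def fun_eq_iff zero_prod_def)

lemma snd_half_pair_seq: "snd_half m (pair_seq x) = pair_seq (snd_half (2 * m) x)"
  by (simp add: snd_half_def pair_seq_def fun_eq_iff algebra_simps)

lemma continuous_on_pair_seq:
  "continuous_on S (pair_seq :: (nat \<Rightarrow> 'a::topological_space) \<Rightarrow> _)"
  unfolding pair_seq_def
  by (intro continuous_on_coordinatewise_then_product continuous_on_Pair
      continuous_on_coord[OF continuous_on_id])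

lemma continuous_on_unpair_seq:
  "continuous_on S (unpair_seq :: (nat \<Rightarrow> 'a::topological_space \<times> 'a) \<Rightarrow> _)"
proof (rule continuous_on_coordinatewise_then_product)
  fix i show "continuous_on S (\<lambda>y :: nat \<Rightarrow> 'a \<times> 'a. unpair_seq y i)"
    using continuous_on_fst[OF continuous_on_coord[OF continuous_on_id[of S], of "i div 2"]]
      continuous_on_snd[OF continuous_on_coord[OF continuous_on_id[of S], of "i div 2"]]
    by (cases "even i") (simp_all add: unpair_seq_def)
qed

lemma Ck_power_pair_seq:
  "Ck_power k (2 * m) {x. pair_seq x \<in> W} (\<lambda>x. \<Psi> (pair_seq x)) \<longleftrightarrow> Ck_power k m W \<Psi>"
proof (induction k arbitrary: m W \<Psi>)
  have cont: "continuous_on {x. pair_seq x \<in> W} (\<lambda>x. \<Psi> (pair_seq x)) \<longleftrightarrow> continuous_on W \<Psi>" for W and \<Psi> :: "_ \<Rightarrow> 'b"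
    by (rule continuous_on_comp_iff[where g = unpair_seq])
       (auto intro: continuous_on_pair_seq continuous_on_unpair_seq)
  {
    case 0
    show ?case by (simp add: cont)
  next
    case (Suc k)
    have dom: "tangent_dom (2 * m) {x. pair_seq x \<in> W} = {x. pair_seq x \<in> tangent_dom m W}"
      by (auto simp: tangent_dom_def pair_seq_power_space fst_half_pair_seq)
    have map: "tangent_map (2 * m) (\<lambda>x. \<Psi> (pair_seq x)) = (\<lambda>x. tangent_map m \<Psi> (pair_seq x))"
      unfolding tangent_map_def fst_half_pair_seq snd_half_pair_seq
      by (rule ext, rule dir_deriv_cong) (simp add: pair_seq_line)
    have hd: "has_dir_deriv (\<lambda>x. \<Psi> (pair_seq x)) l x v \<longleftrightarrow> has_dir_deriv \<Psi> l (pair_seq x) (pair_seq v)" for l x v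
      by (rule has_dir_deriv_cong) (simp add: pair_seq_line)
    have ex: "(\<forall>x\<in>{x. pair_seq x \<in> W}. \<forall>v\<in>power_space (2 * m). \<exists>l. has_dir_deriv (\<lambda>x. \<Psi> (pair_seq x)) l x v)
        \<longleftrightarrow> (\<forall>x\<in>W. \<forall>v\<in>power_space m. \<exists>l. has_dir_deriv \<Psi> l x v)"
      unfolding hd pair_seq_power_space[symmetric] Ball_def mem_Collect_eq
      by (metis pair_unpair)
    show ?case
      unfolding Ck_power.simps dom map cont ex Suc.IH ..
  }
qed

theorem Ck_on_0: "Ck_on 0 U \<Phi> \<longleftrightarrow> continuous_on U \<Phi>"
  unfolding Ck_on_def Ck_power.simps
proof (rule continuous_on_comp_iff[where g = "\<lambda>x i. if i = 0 then x else 0"])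
  show "continuous_on {x \<in> power_space 1. x 0 \<in> U} (\<lambda>x. x 0)"
    by (rule continuous_on_coord[OF continuous_on_id])
  show "continuous_on U (\<lambda>x i. if i = (0::nat) then x else 0)"
  proof (rule continuous_on_coordinatewise_then_product)
    fix i :: nat
    show "continuous_on U (\<lambda>x. if i = 0 then x else 0)" by (cases "i = 0") simp_all
  qed
qed (auto simp: power_space_def)

theorem Ck_on_Suc:
  "Ck_on (Suc k) U \<Phi> \<longleftrightarrow> C1_on U \<Phi> \<and> Ck_on k (U \<times> UNIV) (\<lambda>(x, v). dir_deriv \<Phi> x v)"
proof -
  let ?W = "{x \<in> power_space 1. x 0 \<in> U}" and ?\<Phi> = "\<lambda>x::nat \<Rightarrow> 'a. \<Phi> (x 0)"
  let ?d = "\<lambda>(x, v). dir_deriv \<Phi> x v"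
  let ?e = "\<lambda>x i. if i = (0::nat) then x else (0::'a)"
  have cont: "continuous_on ?W ?\<Phi> \<longleftrightarrow> continuous_on U \<Phi>"
    using Ck_on_0[of U \<Phi>] by (simp add: Ck_on_def)
  have hd: "has_dir_deriv ?\<Phi> l x v \<longleftrightarrow> has_dir_deriv \<Phi> l (x 0) (v 0)" for l x v
    by (rule has_dir_deriv_cong) simp
  have ex: "(\<forall>x\<in>?W. \<forall>v\<in>power_space 1. \<exists>l. has_dir_deriv ?\<Phi> l x v) \<longleftrightarrow> (\<forall>x\<in>U. \<forall>v. \<exists>l. has_dir_deriv \<Phi> l x v)"
    (is "?L \<longleftrightarrow> ?R")
  proof
    assume L: ?L
    have "?e x \<in> power_space 1" for x by (simp add: power_space_def)
    with L have "\<exists>l. has_dir_deriv ?\<Phi> l (?e x) (?e v)" if "x \<in> U" for x v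
      using that by simp
    then show ?R by (simp add: hd)
  qed (auto simp: hd)
  have dom: "tangent_dom 1 ?W = {z. pair_seq z \<in> {y \<in> power_space 1. y 0 \<in> U \<times> UNIV}}"
    unfolding tangent_dom_def mem_Collect_eq pair_seq_power_space
    by (auto simp: fst_half_def power_space_def pair_seq_def)
  have map: "tangent_map 1 ?\<Phi> = (\<lambda>z. ?d (pair_seq z 0))"
    unfolding tangent_map_def
    by (rule ext, simp add: pair_seq_def, rule dir_deriv_cong) (simp add: fst_half_def snd_half_def)
  have rec: "Ck_power k 2 (tangent_dom 1 ?W) (tangent_map 1 ?\<Phi>) \<longleftrightarrow> Ck_on k (U \<times> UNIV) ?d" for k
    using Ck_power_pair_seq[of k 1 "{y \<in> power_space 1. y 0 \<in> U \<times> UNIV}" "\<lambda>y. ?d (y 0)"]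
    unfolding dom map Ck_on_def by simp
  show ?thesis
    using cont ex rec[of 0] rec[of k] by (simp add: Ck_on_def[of "Suc k"] C1_on_def Ck_on_0)
qed

section \<open>The \<open>c\<^sup>\<infinity>\<close>-topology\<close>

text \<open>For a closed subspace \<open>S\<close> (such as \<open>E\<^sup>n\<close> inside \<open>nat \<Rightarrow> 'a\<close>), the smooth curves in \<open>S\<close> are the
  smooth curves in the ambient space with values in \<open>S\<close>: by the following lemma all
  derivatives take values in \<open>S\<close> as well.\<close>

lemma dir_deriv_in_closed_subspace:
  fixes \<Phi> :: "'a::real_vector \<Rightarrow> 'b::{real_vector,t2_space}"
  assumes "closed S" "subspace S" "range \<Phi> \<subseteq> S" "has_dir_deriv \<Phi> l x v"
  shows "l \<in> S"
proof (rule Lim_in_closed_set[OF assms(1) _ _ assms(4)[unfolded has_dir_deriv_def]])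
  show "\<forall>\<^sub>F t in at 0. (\<Phi> (x + t *\<^sub>R v) - \<Phi> x) /\<^sub>R t \<in> S"
    using assms by (intro always_eventually allI subspace_scale subspace_diff) auto
qed simp

lemma subspace_power_space: "subspace (power_space n)"
  by (auto simp: subspace_def power_space_def)

definition smooth_curves_in :: "'a::locally_convex_space set \<Rightarrow> (real \<Rightarrow> 'a) set"
  where "smooth_curves_in S = {c. smooth_on UNIV c \<and> range c \<subseteq> S}"

definition c_infinity_topology :: "'a::locally_convex_space set \<Rightarrow> 'a topology"
  where "c_infinity_topology S =
    topology (\<lambda>W. W \<subseteq> S \<and> (\<forall>c\<in>smooth_curves_in S. open (c -` W)))"

lemma openin_c_infinity_topology:
  "openin (c_infinity_topology S) W \<longleftrightarrow> W \<subseteq> S \<and> (\<forall>c\<in>smooth_curves_in S. open (c -` W))"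
proof -
  have "istopology (\<lambda>W. W \<subseteq> S \<and> (\<forall>c\<in>smooth_curves_in S. open (c -` W)))"
    unfolding istopology_def by (auto simp: vimage_Int vimage_Union)
  then show ?thesis
    by (simp add: c_infinity_topology_def topology_inverse')
qed

lemma topspace_c_infinity_topology [simp]: "topspace (c_infinity_topology S) = S"
proof
  show "S \<subseteq> topspace (c_infinity_topology S)"
  proof (rule openin_subset)
    have "c -` S = UNIV" if "c \<in> smooth_curves_in S" for c
      using that by (auto simp: smooth_curves_in_def)
    then show "openin (c_infinity_topology S) S" by (simp add: openin_c_infinity_topology)
  qed
  show "topspace (c_infinity_topology S) \<subseteq> S"
    using openin_topspace[of "c_infinity_topology S"] by (simp only: openin_c_infinity_topology)
qed

lemma continuous_map_c_infinity_topology: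
  "c \<in> smooth_curves_in S \<Longrightarrow> continuous_map euclidean (c_infinity_topology S) c"
  by (auto simp: continuous_map openin_c_infinity_topology smooth_curves_in_def vimage_def)

lemma c_infinity_topology_finest:
  assumes "topspace T = S" "\<And>c. c \<in> smooth_curves_in S \<Longrightarrow> continuous_map euclidean T c"
    and "openin T W"
  shows "openin (c_infinity_topology S) W"
  using assms openin_subset[OF assms(3)]
  by (auto simp: openin_c_infinity_topology continuous_map vimage_def)

section \<open>Mackey completeness\<close>

definition absolutely_convex :: "'a::real_vector set \<Rightarrow> bool"
  where "absolutely_convex B \<longleftrightarrow>
    (\<forall>x\<in>B. \<forall>y\<in>B. \<forall>a b. \<bar>a\<bar> + \<bar>b\<bar> \<le> 1 \<longrightarrow> a *\<^sub>R x + b *\<^sub>R y \<in> B)"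

definition tvs_bounded :: "'a::locally_convex_space set \<Rightarrow> bool"
  where "tvs_bounded B \<longleftrightarrow> (\<forall>N. open N \<and> 0 \<in> N \<longrightarrow> (\<exists>r>0. B \<subseteq> (*\<^sub>R) r ` N))"

definition directed_set :: "'i set \<Rightarrow> ('i \<Rightarrow> 'i \<Rightarrow> bool) \<Rightarrow> bool"
  where "directed_set I R \<longleftrightarrow> I \<noteq> {} \<and> (\<forall>i\<in>I. R i i) \<and>
    (\<forall>i\<in>I. \<forall>j\<in>I. \<forall>k\<in>I. R i j \<longrightarrow> R j k \<longrightarrow> R i k) \<and>
    (\<forall>i\<in>I. \<forall>j\<in>I. \<exists>k\<in>I. R i k \<and> R j k)"

text \<open>A net \<open>x\<close> indexed by \<open>I\<close> converges to \<open>l\<close> iff \<open>(x \<longlongrightarrow> l) (tails I R)\<close>; for double nets,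
  indexed by \<open>I \<times> I\<close> with the product order, use the product filter.\<close>

definition tails :: "'i set \<Rightarrow> ('i \<Rightarrow> 'i \<Rightarrow> bool) \<Rightarrow> 'i filter"
  where "tails I R = (INF i\<in>I. principal {j\<in>I. R i j})"

definition mackey_cauchy :: "'i set \<Rightarrow> ('i \<Rightarrow> 'i \<Rightarrow> bool) \<Rightarrow> ('i \<Rightarrow> 'a::locally_convex_space) \<Rightarrow> bool"
  where "mackey_cauchy I R x \<longleftrightarrow> (\<exists>B \<mu>. absolutely_convex B \<and> tvs_bounded B \<and>
    ((\<lambda>(i, j). \<mu> i j :: real) \<longlongrightarrow> 0) (tails I R \<times>\<^sub>F tails I R) \<and>
    (\<forall>i\<in>I. \<forall>j\<in>I. x i - x j \<in> (*\<^sub>R) (\<mu> i j) ` B))"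

text \<open>A definition cannot quantify over all index types. Every net in \<open>'a\<close> has the same tails as one
  whose indices are pairs \<open>(A, y)\<close> of a tail \<open>A\<close> and a point \<open>y \<in> A\<close>, so the index type
  \<open>'a set \<times> 'a\<close> suffices; theorem \<open>mackey_complete_net\<close> recovers arbitrary index types.\<close>

definition mackey_complete :: "'a::locally_convex_space itself \<Rightarrow> bool"
  where "mackey_complete TYPE('a) \<longleftrightarrow>
    (\<forall>(I :: ('a set \<times> 'a) set) R (x :: 'a set \<times> 'a \<Rightarrow> 'a).
       directed_set I R \<and> mackey_cauchy I R x \<longrightarrow> (\<exists>l. (x \<longlongrightarrow> l) (tails I R)))"

lemma eventually_tails:
  assumes "directed_set I R"
  shows "eventually P (tails I R) \<longleftrightarrow> (\<exists>i\<in>I. \<forall>j\<in>I. R i j \<longrightarrow> P j)"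
proof -
  have "eventually P (tails I R) \<longleftrightarrow> (\<exists>i\<in>I. eventually P (principal {j\<in>I. R i j}))"
    unfolding tails_def
  proof (rule eventually_INF_base)
    show "I \<noteq> {}" using assms by (simp add: directed_set_def)
    fix i j assume ij: "i \<in> I" "j \<in> I"
    with assms obtain k where k: "k \<in> I" "R i k" "R j k" unfolding directed_set_def by meson
    have "{l\<in>I. R k l} \<subseteq> {l\<in>I. R i l} \<inter> {l\<in>I. R j l}"
      using assms ij k unfolding directed_set_def by blast
    then show "\<exists>k\<in>I. principal {l\<in>I. R k l} \<le> inf (principal {l\<in>I. R i l}) (principal {l\<in>I. R j l})"
      using k by (intro bexI[of _ k]) simp_all
  qed
  then show ?thesis by (auto simp: eventually_principal)
qed

lemma absolutely_convex_multiples: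
  assumes "absolutely_convex B" "\<bar>r\<bar> \<le> s" "z \<in> (*\<^sub>R) r ` B"
  shows "z \<in> (*\<^sub>R) s ` B"
proof (cases "s = 0")
  case True
  with assms show ?thesis by simp
next
  case False
  obtain b where b: "b \<in> B" "z = r *\<^sub>R b" using assms(3) by auto
  have "\<bar>r / s\<bar> + \<bar>0\<bar> \<le> 1" using assms(2) False by (simp add: abs_divide)
  then have "(r / s) *\<^sub>R b + 0 *\<^sub>R b \<in> B"
    using assms(1) b(1) unfolding absolutely_convex_def by blast
  moreover have "z = s *\<^sub>R ((r / s) *\<^sub>R b + 0 *\<^sub>R b)" using b(2) False by simp
  ultimately show ?thesis by (rule rev_image_eqI)
qed

lemma absolutely_convex_gauge:
  fixes B :: "'a::locally_convex_space set"
  assumes "absolutely_convex B" "tvs_bounded B"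
  obtains \<rho> :: "'a \<Rightarrow> real"
  where "\<And>r z. z \<in> (*\<^sub>R) r ` B \<Longrightarrow> z \<in> (*\<^sub>R) (\<rho> z) ` B \<and> 0 \<le> \<rho> z \<and> \<rho> z \<le> 2 * \<bar>r\<bar>"
proof -
  define G where "G z = {r. 0 \<le> r \<and> z \<in> (*\<^sub>R) r ` B}" for z
  define \<rho> where "\<rho> z = (if z = 0 then 0 else 2 * Inf (G z))" for z
  have "z \<in> (*\<^sub>R) (\<rho> z) ` B \<and> 0 \<le> \<rho> z \<and> \<rho> z \<le> 2 * \<bar>r\<bar>" if z: "z \<in> (*\<^sub>R) r ` B" for r z
  proof (cases "z = 0")
    case True
    obtain b where "b \<in> B" using z by blast
    then have "0 \<in> (*\<^sub>R) 0 ` B" by (rule rev_image_eqI) simp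
    with True show ?thesis by (simp add: \<rho>_def)
  next
    case False
    have rG: "\<bar>r\<bar> \<in> G z"
      using absolutely_convex_multiples[OF assms(1) _ z, of "\<bar>r\<bar>"] by (simp add: G_def)
    have bdd: "bdd_below (G z)" by (rule bdd_belowI[of _ 0]) (simp add: G_def)
    have le: "Inf (G z) \<le> \<bar>r\<bar>" by (rule cInf_lower[OF rG bdd])
    obtain N where N: "open N" "0 \<in> N" "z \<notin> N"
      using False separation_t1[of 0 z] by auto
    obtain C where C: "convex C" "open C" "0 \<in> C" "C \<subseteq> N"
      using locally_convex_convex[OF N(1,2)] by auto
    obtain s where s: "s > 0" "B \<subseteq> (*\<^sub>R) s ` C"
      using assms(2) C(2,3) unfolding tvs_bounded_def by meson
    have "1 / s \<le> q" if q: "q \<in> G z" for q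
    proof (rule ccontr)
      assume "\<not> 1 / s \<le> q"
      then have qs: "q * s \<le> 1" using s(1) by (simp add: field_simps)
      obtain b where b: "b \<in> B" "z = q *\<^sub>R b" "0 \<le> q" using q by (auto simp: G_def)
      obtain c where c: "c \<in> C" "b = s *\<^sub>R c" using b(1) s(2) by blast
      have "(q * s) *\<^sub>R c + (1 - q * s) *\<^sub>R 0 \<in> C"
        using C(1,3) c(1) b(3) s(1) qs by (intro convexD) auto
      then have "z \<in> C" by (simp add: b(2) c(2))
      then show False using C(4) N(3) by blast
    qed
    moreover have "G z \<noteq> {}" using rG by blast
    ultimately have "1 / s \<le> Inf (G z)" by (intro cInf_greatest)
    moreover have "0 < 1 / s" using s(1) by simp
    ultimately have pos: "0 < Inf (G z)" by linarith
    then have "Inf (G z) < 2 * Inf (G z)" by linarith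
    then obtain q where q: "q \<in> G z" "q < 2 * Inf (G z)"
      using cInf_lessD[OF \<open>G z \<noteq> {}\<close>] by blast
    have "z \<in> (*\<^sub>R) (2 * Inf (G z)) ` B"
    proof (rule absolutely_convex_multiples[OF assms(1)])
      show "\<bar>q\<bar> \<le> 2 * Inf (G z)" "z \<in> (*\<^sub>R) q ` B" using q unfolding G_def by simp_all
    qed
    with le pos False show ?thesis by (simp add: \<rho>_def)
  qed
  then show ?thesis by (rule that)
qed

theorem mackey_complete_net:
  fixes x :: "'i \<Rightarrow> 'a::locally_convex_space"
  assumes "mackey_complete TYPE('a)" "directed_set I R" "mackey_cauchy I R x"
  shows "\<exists>l. (x \<longlongrightarrow> l) (tails I R)"
proof -
  obtain B \<mu> where B: "absolutely_convex B" "tvs_bounded B"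
    and \<mu>: "((\<lambda>(i, j). \<mu> i j :: real) \<longlongrightarrow> 0) (tails I R \<times>\<^sub>F tails I R)"
    and x: "\<And>i j. i \<in> I \<Longrightarrow> j \<in> I \<Longrightarrow> x i - x j \<in> (*\<^sub>R) (\<mu> i j) ` B"
    using assms(3) unfolding mackey_cauchy_def by blast
  obtain \<rho> where \<rho>: "\<And>r z. z \<in> (*\<^sub>R) r ` B \<Longrightarrow> z \<in> (*\<^sub>R) (\<rho> z) ` B \<and> 0 \<le> \<rho> z \<and> \<rho> z \<le> 2 * \<bar>r\<bar>"
    using absolutely_convex_gauge[OF B] by blast
  define T where "T i = x ` {j\<in>I. R i j}" for i
  define J where "J = {p. \<exists>i\<in>I. fst p = T i \<and> snd p \<in> T i}"
  define Q where "Q = (\<lambda>(p :: 'a set \<times> 'a) (q :: 'a set \<times> 'a). fst q \<subseteq> fst p)"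
  have refl: "R i i" if "i \<in> I" for i using that assms(2) by (simp add: directed_set_def)
  have xT: "x i \<in> T i" if "i \<in> I" for i using that refl by (auto simp: T_def)
  have TJ: "(T i, x j) \<in> J" if "i \<in> I" "j \<in> I" "R i j" for i j
    using that by (auto simp: J_def T_def)
  have dirJ: "directed_set J Q"
    unfolding directed_set_def
  proof (intro conjI ballI impI)
    obtain i where "i \<in> I" using assms(2) by (auto simp: directed_set_def)
    then show "J \<noteq> {}" using TJ refl by blast
  next
    fix p q assume "p \<in> J" "q \<in> J"
    then obtain i j where ij: "i \<in> I" "fst p = T i" "j \<in> I" "fst q = T j" by (auto simp: J_def)
    obtain k where k: "k \<in> I" "R i k" "R j k"
      using assms(2) ij unfolding directed_set_def by meson
    have "{l\<in>I. R k l} \<subseteq> {l\<in>I. R i l} \<inter> {l\<in>I. R j l}"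
      using assms(2) ij k unfolding directed_set_def by blast
    then have "T k \<subseteq> T i" "T k \<subseteq> T j" unfolding T_def by auto
    then show "\<exists>k\<in>J. Q p k \<and> Q q k"
      using ij TJ[OF k(1) k(1) refl[OF k(1)]] by (intro bexI[of _ "(T k, x k)"]) (auto simp: Q_def)
  qed (auto simp: Q_def)
  have val: "\<exists>i\<in>I. snd p = x i" if "p \<in> J" for p
    using that by (auto simp: J_def T_def)
  have "mackey_cauchy J Q snd"
    unfolding mackey_cauchy_def
  proof (intro exI[of _ B] exI[of _ "\<lambda>p q. \<rho> (snd p - snd q)"] conjI B ballI)
    fix p q assume "p \<in> J" "q \<in> J"
    then obtain i j where "i \<in> I" "j \<in> I" "snd p = x i" "snd q = x j" using val by metis
    then show "snd p - snd q \<in> (*\<^sub>R) (\<rho> (snd p - snd q)) ` B" using \<rho>[OF x] by metis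
  next
    show "((\<lambda>(p, q). \<rho> (snd p - snd q)) \<longlongrightarrow> 0) (tails J Q \<times>\<^sub>F tails J Q)"
    proof (rule tendstoI)
      fix e :: real assume "e > 0"
      then have "\<forall>\<^sub>F p in tails I R \<times>\<^sub>F tails I R. dist (case p of (i, j) \<Rightarrow> \<mu> i j) 0 < e / 2"
        using \<mu> by (intro tendstoD) auto
      then obtain P P' where P: "eventually P (tails I R)" "eventually P' (tails I R)"
        "\<And>i j. P i \<Longrightarrow> P' j \<Longrightarrow> \<bar>\<mu> i j\<bar> < e / 2"
        unfolding eventually_prod_filter by auto
      obtain a a' where a: "a \<in> I" "\<And>j. j \<in> I \<Longrightarrow> R a j \<Longrightarrow> P j" "a' \<in> I" "\<And>j. j \<in> I \<Longrightarrow> R a' j \<Longrightarrow> P' j"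
        using P(1,2) unfolding eventually_tails[OF assms(2)] by blast
      have 1: "eventually (\<lambda>p. p \<in> J \<and> snd p \<in> T i) (tails J Q)" if "i \<in> I" for i
        unfolding eventually_tails[OF dirJ]
        using TJ[OF that that refl[OF that]]
        by (intro bexI[of _ "(T i, x i)"]) (auto simp: Q_def J_def)
      have 2: "dist (\<rho> (snd p - snd q)) 0 < e"
        if p: "p \<in> J \<and> snd p \<in> T a" and q: "q \<in> J \<and> snd q \<in> T a'" for p q
      proof -
        obtain i j where ij: "i \<in> I" "R a i" "snd p = x i" "j \<in> I" "R a' j" "snd q = x j"
          using p q by (auto simp: T_def)
        have "\<bar>\<mu> i j\<bar> < e / 2" using P(3) a ij by blast
        then show ?thesis using \<rho>[OF x[OF ij(1,4)]] ij by auto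
      qed
      show "\<forall>\<^sub>F p in tails J Q \<times>\<^sub>F tails J Q. dist (case p of (p, q) \<Rightarrow> \<rho> (snd p - snd q)) 0 < e"
        unfolding eventually_prod_filter
        using 1[OF a(1)] 1[OF a(3)] 2
        by (intro exI[of _ "\<lambda>p. p \<in> J \<and> snd p \<in> T a"] exI[of _ "\<lambda>p. p \<in> J \<and> snd p \<in> T a'"]) auto
    qed
  qed
  then obtain l where l: "(snd \<longlongrightarrow> l) (tails J Q)"
    using assms(1) dirJ unfolding mackey_complete_def by blast
  have "(x \<longlongrightarrow> l) (tails I R)"
  proof (rule topological_tendstoI)
    fix S assume "open S" "l \<in> S"
    then have "eventually (\<lambda>p. snd p \<in> S) (tails J Q)" using l by (rule topological_tendstoD[rotated])
    then obtain p where p: "p \<in> J" "\<And>q. q \<in> J \<Longrightarrow> Q p q \<Longrightarrow> snd q \<in> S"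
      unfolding eventually_tails[OF dirJ] by blast
    then obtain i where i: "i \<in> I" "fst p = T i" by (auto simp: J_def)
    have "x j \<in> S" if "j \<in> I" "R i j" for j
      using p(2)[OF TJ[OF i(1) that]] i(2) by (simp add: Q_def)
    then show "eventually (\<lambda>j. x j \<in> S) (tails I R)"
      unfolding eventually_tails[OF assms(2)] using i(1) by blast
  qed
  then show ?thesis by blast
qed

end

theory Submission
  imports Defs
begin

text \<open>A smooth map stays smooth when a smooth function is applied to it, by the chain rule, and
  continuous linear functionals are smooth. So the content is that a weakly smooth map \<open>\<Phi>\<close> is
  smooth. Two principles carry this. The first is Mackey's theorem
  (\<open>weakly_bounded_imp_bounded\<close>): in a locally convex space a set is bounded as soon as every
  continuous linear functional is bounded on it. It turns estimates for the real functions
  \<open>f \<circ> \<Phi>\<close>, whose constants depend on \<open>f\<close>, into estimates in \<open>F\<close> itself. It rests on the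
  Hahn--Banach theorem and on the uniform boundedness principle, for which a sequence of
  functionals is summed with suitable signs.

  The second principle is that both steps towards \<open>C\<^sup>1\<close> need such estimates only. Since
  \<open>f \<circ> \<Phi>\<close> is of class \<open>C\<^sup>2\<close>, the difference quotients of \<open>\<Phi>\<close> at parameters \<open>s\<close> and \<open>t\<close> differ
  weakly by \<open>O(\<bar>s\<bar> + \<bar>t\<bar>)\<close>. Hence they form a Mackey--Cauchy net, and the directional
  derivatives exist by Mackey completeness (\<open>weakly_C2_has_dir_deriv\<close>). Furthermore, along a smooth
  curve \<open>c\<close> the increments of a weakly smooth map \<open>\<Psi>\<close> are weakly \<open>O(t)\<close>, hence \<open>\<Psi> \<circ> c\<close> is continuous. As
  the topology of \<open>E\<^sup>n\<close> is the \<open>c\<^sup>\<infinity>\<close>-topology, \<open>\<Psi>\<close> is continuous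
  (\<open>weakly_C1_continuous\<close>).

  The tangent map of \<open>\<Phi>\<close> is again weakly smooth, because continuous linear functionals commute
  with directional derivatives. So both steps apply to it on \<open>E\<^sup>2\<close>, and by induction to
  all iterated tangent maps on the powers of \<open>E\<close> (\<open>weakly_smooth_imp_Ck_power\<close>).

  The chain rule is needed for real-valued outer functions only (\<open>Ck_power_compose\<close>), where the
  classical mean value theorem takes the place of integration in locally convex spaces.\<close>

section \<open>The Hahn--Banach theorem\<close>

definition sublinear :: "('a::real_vector \<Rightarrow> real) \<Rightarrow> bool"
  where "sublinear p \<longleftrightarrow> (\<forall>x y. p (x + y) \<le> p x + p y) \<and> (\<forall>r\<ge>0. \<forall>x. p (r *\<^sub>R x) = r * p x)"

lemma sublinear_add: "sublinear p \<Longrightarrow> p (x + y) \<le> p x + p y"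
  and sublinear_scale: "sublinear p \<Longrightarrow> 0 \<le> r \<Longrightarrow> p (r *\<^sub>R x) = r * p x"
  by (auto simp: sublinear_def)

lemma sublinear_zero: "sublinear p \<Longrightarrow> p 0 = 0"
  using sublinear_scale[of p 0 0] by simp

lemma sublinear_minus: "sublinear p \<Longrightarrow> - p (- x) \<le> p x"
  using sublinear_add[of p x "- x"] sublinear_zero[of p] by simp

text \<open>Only one half of homogeneity has to be checked: the other half is the same inequality for
  the factor \<open>1 / r\<close> at the point \<open>r *\<^sub>R x\<close>.\<close>

lemma sublinearI:
  assumes "\<And>x y. p (x + y) \<le> p x + p y"
    and "\<And>r x. 0 < r \<Longrightarrow> p (r *\<^sub>R x) \<le> r * p x"
    and "p 0 = 0"
  shows "sublinear p"
  unfolding sublinear_def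
proof (intro conjI allI impI assms(1))
  fix r :: real and x
  assume "0 \<le> r"
  show "p (r *\<^sub>R x) = r * p x"
  proof (cases "r = 0")
    case False
    with \<open>0 \<le> r\<close> have r: "0 < r" by simp
    have "p x \<le> (1 / r) * p (r *\<^sub>R x)"
      using assms(2)[of "1 / r" "r *\<^sub>R x"] r by simp
    then show ?thesis
      using assms(2)[OF r, of x] r by (simp add: field_simps)
  qed (simp add: assms(3))
qed

text \<open>The functional \<open>q x = (INF t\<ge>0. p (x + t *\<^sub>R a) - t * p a)\<close> is the largest sublinear functional
  below \<open>p\<close> with \<open>q (- a) \<le> - p a\<close>. It serves twice below: a minimal \<open>p\<close> coincides with it, which
  forces additivity, and starting from it instead of \<open>p\<close> prescribes the value of a linear
  functional at \<open>a\<close>.\<close>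

lemma sublinear_tilt:
  assumes p: "sublinear p"
  obtains q where "sublinear q" "\<And>x. q x \<le> p x" "\<And>x. q x \<le> p (x + a) - p a"
proof
  define \<tau> where "\<tau> x t = p (x + t *\<^sub>R a) - t * p a" for x t
  define q where "q x = (INF t\<in>{0..}. \<tau> x t)" for x
  have lower: "- p (- x) \<le> \<tau> x t" if "0 \<le> t" for x t
    using sublinear_add[OF p, of "x + t *\<^sub>R a" "- x"] sublinear_scale[OF p that, of a]
    by (simp add: \<tau>_def)
  have upper: "q x \<le> \<tau> x t" if "0 \<le> t" for x t
    unfolding q_def by (rule cINF_lower) (use lower that in \<open>auto intro!: bdd_belowI2\<close>)
  have great: "m \<le> q x" if "\<And>t. 0 \<le> t \<Longrightarrow> m \<le> \<tau> x t" for m x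
    unfolding q_def by (rule cINF_greatest) (use that in auto)
  show "sublinear q"
  proof (rule sublinearI)
    fix x y
    have "q (x + y) \<le> \<tau> x s + \<tau> y t" if "0 \<le> s" "0 \<le> t" for s t
      using upper[of "s + t" "x + y"] that
        sublinear_add[OF p, of "x + s *\<^sub>R a" "y + t *\<^sub>R a"]
      by (simp add: \<tau>_def algebra_simps)
    then have "q (x + y) - \<tau> x s \<le> q y" if "0 \<le> s" for s
      using that by (intro great) (simp add: algebra_simps)
    then have "q (x + y) - q y \<le> q x"
      by (intro great) (simp add: algebra_simps)
    then show "q (x + y) \<le> q x + q y" by simp
  next
    fix r :: real and x assume r: "0 < r"
    have "q (r *\<^sub>R x) / r \<le> q x"
    proof (rule great)
      fix t :: real assume "0 \<le> t"
      then have "q (r *\<^sub>R x) \<le> r * \<tau> x t"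
        using upper[of "r * t" "r *\<^sub>R x"] r sublinear_scale[OF p, of r "x + t *\<^sub>R a"]
        by (simp add: \<tau>_def algebra_simps)
      then show "q (r *\<^sub>R x) / r \<le> \<tau> x t"
        using r by (simp add: field_simps)
    qed
    then show "q (r *\<^sub>R x) \<le> r * q x"
      using r by (simp add: field_simps)
  next
    show "q 0 = 0"
      using upper[of 0 0] great[of 0 0] lower[of _ 0] sublinear_zero[OF p] by (simp add: \<tau>_def)
  qed
  show "q x \<le> p x" "q x \<le> p (x + a) - p a" for x
    using upper[of 0 x] upper[of 1 x] by (simp_all add: \<tau>_def)
qed

text \<open>Zorn's lemma applies because every sublinear \<open>q \<le> p\<close> satisfies \<open>- p (- x) \<le> q x\<close>, so that
  chains have pointwise infima; these are again subadditive since in a chain two functionals can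
  be replaced by the smaller one.\<close>

lemma minimal_sublinear_exists:
  assumes p: "sublinear p"
  obtains m where "sublinear m" "m \<le> p" "\<And>q. sublinear q \<Longrightarrow> q \<le> m \<Longrightarrow> q = m"
proof -
  define A where "A = {q. sublinear q \<and> q \<le> p}"
  have "\<exists>m\<in>A. \<forall>q\<in>A. m \<ge> q \<longrightarrow> q = m"
  proof (rule predicate_Zorn)
    show "partial_order_on A (relation_of (\<ge>) A)"
      by (rule partial_order_on_relation_ofI) auto
  next
    fix C assume "C \<in> Chains (relation_of (\<ge>) A)"
    then have CA: "C \<subseteq> A" and tot: "\<And>q q'. q \<in> C \<Longrightarrow> q' \<in> C \<Longrightarrow> q \<le> q' \<or> q' \<le> q"
      by (auto simp: Chains_def relation_of_def)
    show "\<exists>u\<in>A. \<forall>q\<in>C. u \<le> q"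
    proof (cases "C = {}")
      case True
      then show ?thesis using p by (auto simp: A_def)
    next
      case False
      define u where "u x = (INF q\<in>C. q x)" for x
      have lower: "- p (- x) \<le> q x" if "q \<in> C" for q x
      proof -
        have "q (- x) \<le> p (- x)" "sublinear q" using that CA by (auto simp: A_def le_fun_def)
        then show ?thesis using sublinear_minus[of q x] by linarith
      qed
      have upper: "u x \<le> q x" if "q \<in> C" for q x
        unfolding u_def by (rule cINF_lower) (use lower that in \<open>auto intro!: bdd_belowI2\<close>)
      have great: "b \<le> u x" if "\<And>q. q \<in> C \<Longrightarrow> b \<le> q x" for b x
        unfolding u_def by (rule cINF_greatest) (use that False in auto)
      have sub: "sublinear q" if "q \<in> C" for q using that CA by (auto simp: A_def)
      have "sublinear u"
      proof (rule sublinearI)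
        fix x y
        have bound: "u (x + y) \<le> q x + q' y" if "q \<in> C" "q' \<in> C" for q q'
        proof -
          obtain r where r: "r \<in> C" "r \<le> q" "r \<le> q'" using tot \<open>q \<in> C\<close> \<open>q' \<in> C\<close> by blast
          have "u (x + y) \<le> r x + r y"
            using upper[OF r(1), of "x + y"] sublinear_add[OF sub[OF r(1)], of x y] by linarith
          also have "\<dots> \<le> q x + q' y" using r(2,3) by (intro add_mono) (auto simp: le_fun_def)
          finally show ?thesis .
        qed
        have "u (x + y) - q x \<le> u y" if "q \<in> C" for q
        proof (rule great)
          fix q' assume "q' \<in> C"
          then show "u (x + y) - q x \<le> q' y" using bound[OF that, of q'] by simp
        qed
        then have "u (x + y) - u y \<le> u x"
          by (intro great) (simp add: algebra_simps)
        then show "u (x + y) \<le> u x + u y" by simp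
      next
        fix r :: real and x assume r: "0 < r"
        have "u (r *\<^sub>R x) / r \<le> u x"
        proof (rule great)
          fix q assume "q \<in> C"
          then show "u (r *\<^sub>R x) / r \<le> q x"
            using upper[of q "r *\<^sub>R x"] r sublinear_scale[OF sub, of q r x] by (simp add: field_simps)
        qed
        then show "u (r *\<^sub>R x) \<le> r * u x" using r by (simp add: field_simps)
      next
        have "(\<lambda>q. q 0) ` C = (\<lambda>_. 0) ` C" using sublinear_zero[OF sub] by (rule image_cong[OF refl])
        then have "(\<lambda>q. q 0) ` C = {0}" using False by (simp add: image_constant_conv)
        then show "u 0 = 0" by (simp add: u_def)
      qed
      moreover obtain q where "q \<in> C" using False by blast
      then have "u \<le> q" "q \<le> p"
        using upper CA by (auto simp: A_def le_fun_def)
      then have "u \<le> p" by (rule order_trans)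
      ultimately show ?thesis using upper by (auto simp: A_def le_fun_def)
    qed
  qed
  then obtain m where "m \<in> A" "\<And>q. q \<in> A \<Longrightarrow> q \<le> m \<Longrightarrow> q = m" by blast
  then show ?thesis by (intro that[of m]) (auto simp: A_def intro: order_trans)
qed

lemma minimal_sublinear_linear:
  assumes m: "sublinear m" and min: "\<And>q. sublinear q \<Longrightarrow> q \<le> m \<Longrightarrow> q = m"
  shows "linear m"
proof -
  have add: "m (x + y) = m x + m y" for x y
  proof -
    obtain q where q: "sublinear q" "\<And>x. q x \<le> m x" "\<And>x. q x \<le> m (x + y) - m y"
      using sublinear_tilt[OF m, where a = y] by blast
    have "q = m" using min q(1,2) by (simp add: le_fun_def)
    then show ?thesis using q(3)[of x] sublinear_add[OF m, of x y] by simp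
  qed
  have neg: "m (- x) = - m x" for x
    using add[of x "- x"] sublinear_zero[OF m] by simp
  show ?thesis
  proof (rule linearI[OF add])
    fix r :: real and x
    show "m (r *\<^sub>R x) = r *\<^sub>R m x"
      using sublinear_scale[OF m, of r x] sublinear_scale[OF m, of "- r" x] neg[of "r *\<^sub>R x"]
      by (cases "0 \<le> r") auto
  qed
qed

text \<open>A minimal sublinear functional below the tilted functional \<open>q\<close> of \<open>sublinear_tilt\<close> is linear.
  It takes the value \<open>p a\<close> at \<open>a\<close> because \<open>q (- a) \<le> - p a\<close>.\<close>

theorem hahn_banach_support:
  assumes p: "sublinear p"
  obtains f where "linear f" "\<And>x. f x \<le> p x" "f a = p a"
proof -
  obtain q where q: "sublinear q" "\<And>x. q x \<le> p x" "\<And>x. q x \<le> p (x + a) - p a"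
    using sublinear_tilt[OF p, where a = a] by blast
  obtain m where m: "sublinear m" "m \<le> q" "\<And>q. sublinear q \<Longrightarrow> q \<le> m \<Longrightarrow> q = m"
    using minimal_sublinear_exists[OF q(1)] by blast
  have lin: "linear m" by (rule minimal_sublinear_linear[OF m(1,3)])
  have le: "m x \<le> p x" for x using m(2) q(2) by (meson le_funD order_trans)
  have "m (- a) \<le> - p a"
    using le_funD[OF m(2), of "- a"] q(3)[of "- a"] sublinear_zero[OF p] by simp
  then have "m a = p a" using le[of a] linear_neg[OF lin, of a] by simp
  then show ?thesis using that lin le by blast
qed

section \<open>Weakly bounded sets are bounded\<close>

lemma symmetric_convex_neighbourhood:
  fixes N :: "'a::locally_convex_space set"
  assumes "open N" "0 \<in> N"
  obtains C where "convex C" "open C" "0 \<in> C" "C \<subseteq> N" "\<And>x. x \<in> C \<Longrightarrow> - x \<in> C"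
proof -
  obtain D where D: "convex D" "open D" "0 \<in> D" "D \<subseteq> N"
    using locally_convex_convex[OF assms] by blast
  have "open (uminus -` D)"
    by (rule open_vimage[OF D(2)]) (intro continuous_intros)
  moreover have "convex (uminus -` D)"
    using D(1) by (intro convex_linear_vimage) (auto intro: linear_uminus)
  ultimately show ?thesis
    using D by (intro that[of "D \<inter> uminus -` D"]) (auto intro: convex_Int)
qed

lemma convex_scale_mem:
  assumes "convex C" "0 \<in> C" "x \<in> C" "0 \<le> r" "r \<le> 1"
  shows "r *\<^sub>R x \<in> C"
  using convexD[OF assms(1,3,2), of r "1 - r"] assms(4,5) by simp

lemma open_absorbing:
  fixes C :: "'a::locally_convex_space set"
  assumes "open C" "0 \<in> C"
  obtains s where "0 < s" "(1 / s) *\<^sub>R x \<in> C"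
proof -
  have "((\<lambda>t. t *\<^sub>R x) \<longlongrightarrow> 0 *\<^sub>R x) (at_right (0::real))"
    by (intro tendsto_scaleR_lcs tendsto_const tendsto_ident_at)
  then have "\<forall>\<^sub>F t in at_right (0::real). t *\<^sub>R x \<in> C"
    using assms by (intro topological_tendstoD) auto
  then have "\<forall>\<^sub>F t in at_right (0::real). t *\<^sub>R x \<in> C \<and> 0 < t"
    using eventually_at_right_less by (rule eventually_conj)
  then obtain t :: real where "0 < t" "t *\<^sub>R x \<in> C"
    using eventually_happens[of _ "at_right (0::real)"] by auto
  then show ?thesis by (intro that[of "1 / t"]) auto
qed

definition minkowski_functional :: "'a::real_vector set \<Rightarrow> 'a \<Rightarrow> real"
  where "minkowski_functional C x = Inf {s. 0 < s \<and> (1 / s) *\<^sub>R x \<in> C}"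

lemma minkowski_functional_le:
  assumes "0 < s" "(1 / s) *\<^sub>R x \<in> C"
  shows "minkowski_functional C x \<le> s"
  unfolding minkowski_functional_def by (rule cInf_lower) (use assms in \<open>auto intro!: bdd_belowI[of _ 0]\<close>)

lemma minkowski_functional_greatest:
  fixes C :: "'a::locally_convex_space set"
  assumes "open C" "0 \<in> C" "\<And>s. 0 < s \<Longrightarrow> (1 / s) *\<^sub>R x \<in> C \<Longrightarrow> b \<le> s"
  shows "b \<le> minkowski_functional C x"
  unfolding minkowski_functional_def
  by (rule cInf_greatest) (use assms(3) open_absorbing[OF assms(1,2), of x] in auto)

lemma sublinear_minkowski_functional:
  fixes C :: "'a::locally_convex_space set"
  assumes C: "convex C" "open C" "0 \<in> C"
  shows "sublinear (minkowski_functional C)"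
proof (rule sublinearI)
  note great = minkowski_functional_greatest[OF C(2,3)]
  fix x y
  have "minkowski_functional C (x + y) \<le> s + t"
    if s: "0 < s" "(1 / s) *\<^sub>R x \<in> C" and t: "0 < t" "(1 / t) *\<^sub>R y \<in> C" for s t
  proof (rule minkowski_functional_le)
    have "(s / (s + t)) *\<^sub>R ((1 / s) *\<^sub>R x) + (t / (s + t)) *\<^sub>R ((1 / t) *\<^sub>R y) \<in> C"
      using s t by (intro convexD[OF C(1)]) (auto simp: add_divide_distrib[symmetric])
    then show "(1 / (s + t)) *\<^sub>R (x + y) \<in> C"
      using s t by (simp add: scaleR_add_right)
  qed (use s t in simp)
  then have "minkowski_functional C (x + y) - s \<le> t"
    if "0 < s" "(1 / s) *\<^sub>R x \<in> C" "0 < t" "(1 / t) *\<^sub>R y \<in> C" for s t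
    using that by (simp add: diff_le_eq add.commute)
  then have "minkowski_functional C (x + y) - s \<le> minkowski_functional C y" if "0 < s" "(1 / s) *\<^sub>R x \<in> C" for s
    using that by (intro great) auto
  then have "minkowski_functional C (x + y) - minkowski_functional C y \<le> minkowski_functional C x"
    by (intro great) (simp add: algebra_simps)
  then show "minkowski_functional C (x + y) \<le> minkowski_functional C x + minkowski_functional C y" by simp
next
  fix r :: real and x assume r: "0 < r"
  have "minkowski_functional C (r *\<^sub>R x) / r \<le> minkowski_functional C x"
  proof (rule minkowski_functional_greatest[OF C(2,3)])
    fix s :: real assume "0 < s" "(1 / s) *\<^sub>R x \<in> C"
    then have "minkowski_functional C (r *\<^sub>R x) \<le> r * s"
      using r by (intro minkowski_functional_le) auto
    then show "minkowski_functional C (r *\<^sub>R x) / r \<le> s" using r by (simp add: field_simps)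
  qed
  then show "minkowski_functional C (r *\<^sub>R x) \<le> r * minkowski_functional C x" using r by (simp add: field_simps)
next
  have "0 \<le> minkowski_functional C 0" by (rule minkowski_functional_greatest[OF C(2,3)]) simp
  moreover have "minkowski_functional C 0 \<le> 0"
    by (rule field_le_epsilon) (use minkowski_functional_le[of _ "0::'a" C] C(3) in simp)
  ultimately show "minkowski_functional C 0 = 0" by simp
qed

text \<open>Since \<open>C\<close> is symmetric, so is its Minkowski functional; hence the one-sided estimate of the
  Hahn--Banach theorem becomes an estimate of the absolute value.\<close>

lemma norming_functional:
  fixes C :: "'a::locally_convex_space set"
  assumes C: "convex C" "open C" "0 \<in> C" "\<And>x. x \<in> C \<Longrightarrow> - x \<in> C"
  obtains f :: "'a \<Rightarrow> real" where "linear f" "\<And>x. \<bar>f x\<bar> \<le> minkowski_functional C x" "f a = minkowski_functional C a"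
proof -
  obtain f where f: "linear f" "\<And>x. f x \<le> minkowski_functional C x" "f a = minkowski_functional C a"
    using hahn_banach_support[OF sublinear_minkowski_functional[OF C(1-3)]] by blast
  have "minkowski_functional C (- x) \<le> minkowski_functional C x" for x
    by (rule minkowski_functional_greatest[OF C(2,3)], rule minkowski_functional_le) (use C(4) in force)+
  then have "\<bar>f x\<bar> \<le> minkowski_functional C x" for x
    using f(2)[of x] order_trans[OF f(2)[of "- x"]] linear_neg[OF f(1), of x] by (simp add: abs_le_iff)
  then show ?thesis using that f by blast
qed

lemma linear_continuous_lcs:
  fixes f :: "'a::locally_convex_space \<Rightarrow> real"
  assumes f: "linear f" and N: "open N" "0 \<in> N" "\<And>x. x \<in> N \<Longrightarrow> \<bar>f x\<bar> \<le> b"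
  shows "continuous_on UNIV f"
proof -
  have "(f \<longlongrightarrow> f y) (nhds y)" for y
  proof (rule tendstoI)
    fix e :: real assume "e > 0"
    have b: "0 \<le> b" using N(3)[OF N(2)] by simp
    define r where "r = (b + 1) / e"
    have r: "0 < r" using b \<open>e > 0\<close> by (simp add: r_def)
    have "((\<lambda>x. r *\<^sub>R (x - y)) \<longlongrightarrow> r *\<^sub>R (y - y)) (nhds y)"
      by (intro tendsto_scaleR_lcs tendsto_const tendsto_diff filterlim_ident)
    then have "\<forall>\<^sub>F x in nhds y. r *\<^sub>R (x - y) \<in> N"
      using N by (intro topological_tendstoD) auto
    then show "\<forall>\<^sub>F x in nhds y. dist (f x) (f y) < e"
    proof eventually_elim
      case (elim x)
      have "r * \<bar>f x - f y\<bar> < b + 1"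
        using N(3)[OF elim] r by (simp add: linear_scale[OF f] linear_diff[OF f] abs_mult)
      also have "b + 1 = r * e" using \<open>e > 0\<close> by (simp add: r_def)
      finally show ?case using r by (simp add: dist_real_def)
    qed
  qed
  then show ?thesis
    by (auto simp: continuous_on_def intro: tendsto_mono[OF at_within_le_nhds])
qed

text \<open>Mackey's theorem. If \<open>A\<close> is not absorbed by \<open>N\<close>, there are \<open>x\<^sub>k \<in> A\<close> on which the Minkowski
  functional \<open>p\<close> of a convex symmetric \<open>C \<subseteq> N\<close> is at least \<open>4\<^sup>k\<close>; choose functionals \<open>m\<^sub>k\<close> with
  \<open>\<bar>m\<^sub>k\<bar> \<le> p\<close> and \<open>m\<^sub>k x\<^sub>k = p x\<^sub>k\<close>. Then some series \<open>f = \<Sum>k. \<plusminus> 3\<^sup>-\<^sup>k m\<^sub>k\<close> is a continuous linear functional that is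
  unbounded on \<open>A\<close>. Each sign is chosen so that adding the \<open>k\<close>-th term leaves a partial sum of
  absolute value at least \<open>3\<^sup>-\<^sup>k p x\<^sub>k\<close> at \<open>x\<^sub>k\<close>, and all later terms together change this
  by at most half of it, so \<open>\<bar>f x\<^sub>k\<bar> \<ge> (4/3)\<^sup>k / 2\<close>. This is Sokal's argument for the uniform
  boundedness principle.\<close>

theorem weakly_bounded_imp_bounded:
  fixes A :: "'a::locally_convex_space set"
  assumes weak: "\<And>f :: 'a \<Rightarrow> real. linear f \<Longrightarrow> continuous_on UNIV f \<Longrightarrow> \<exists>b. \<forall>x\<in>A. \<bar>f x\<bar> \<le> b"
  shows "tvs_bounded A"
  unfolding tvs_bounded_def
proof (intro allI impI, elim conjE, rule ccontr)
  fix N :: "'a set" assume N: "open N" "0 \<in> N" and no: "\<not> (\<exists>r>0. A \<subseteq> (*\<^sub>R) r ` N)"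
  obtain C where C: "convex C" "open C" "0 \<in> C" "C \<subseteq> N" "\<And>x. x \<in> C \<Longrightarrow> - x \<in> C"
    using symmetric_convex_neighbourhood[OF N] by blast
  define p where "p = minkowski_functional C"
  have "\<exists>x\<in>A. 4 ^ k \<le> p x" for k :: nat
  proof -
    have "\<not> A \<subseteq> (*\<^sub>R) (4 ^ k) ` N" using no by (meson zero_less_power zero_less_numeral)
    then obtain x where x: "x \<in> A" "x \<notin> (*\<^sub>R) (4 ^ k) ` N" by blast
    have "4 ^ k \<le> p x"
      unfolding p_def
    proof (rule minkowski_functional_greatest[OF C(2,3)], rule ccontr)
      fix s :: real assume s: "0 < s" "(1 / s) *\<^sub>R x \<in> C" "\<not> 4 ^ k \<le> s"
      then have "(s / 4 ^ k) *\<^sub>R (1 / s) *\<^sub>R x \<in> C" by (intro convex_scale_mem[OF C(1,3) s(2)]) auto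
      then have "(1 / 4 ^ k) *\<^sub>R x \<in> N" using s C(4) by auto
      then have "4 ^ k *\<^sub>R (1 / 4 ^ k) *\<^sub>R x \<in> (*\<^sub>R) (4 ^ k) ` N" by blast
      then show False using x(2) by simp
    qed
    with x(1) show ?thesis by blast
  qed
  then obtain x where x: "\<And>k. x k \<in> A" and big: "\<And>k. 4 ^ k \<le> p (x k)"
    by metis
  have "\<exists>m. linear m \<and> (\<forall>y. \<bar>m y\<bar> \<le> p y) \<and> m (x k) = p (x k)" for k
    using norming_functional[OF C(1-3,5), where a = "x k"] unfolding p_def by blast
  then have "\<forall>k. \<exists>m. linear m \<and> (\<forall>y. \<bar>m y\<bar> \<le> p y) \<and> m (x k) = p (x k)" by blast
  from choice[OF this] obtain m where lin: "\<And>k. linear (m k)" and mp: "\<And>k y. \<bar>m k y\<bar> \<le> p y"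
    and norming: "\<And>k. m k (x k) = p (x k)"
    by blast
  \<comment> \<open>One of \<open>a + b\<close> and \<open>a - b\<close> has absolute value at least that of \<open>b\<close>.\<close>
  have sign: "\<exists>\<sigma>::real. \<bar>\<sigma>\<bar> = 1 \<and> \<bar>b\<bar> \<le> \<bar>a + \<sigma> * b\<bar>" for a b :: real
  proof (cases "\<bar>b\<bar> \<le> \<bar>a + b\<bar>")
    case True then show ?thesis by (intro exI[of _ 1]) simp
  next
    case False then show ?thesis by (intro exI[of _ "-1"]) linarith
  qed
  define Q where "Q k a b \<longleftrightarrow> (\<exists>\<sigma>::real. \<bar>\<sigma>\<bar> = 1 \<and> (\<forall>y. b y = a y + \<sigma> * ((1/3) ^ k * m k y)) \<and>
      \<bar>(1/3) ^ k * m k (x k)\<bar> \<le> \<bar>b (x k)\<bar>)" for k and a b :: "'a \<Rightarrow> real"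
  have "\<exists>S. \<forall>k. (k = 0 \<longrightarrow> S k = (\<lambda>y. 0)) \<and> Q k (S k) (S (Suc k))"
  proof (rule dependent_nat_choice)
    fix a :: "'a \<Rightarrow> real" and k
    obtain \<sigma> :: real where "\<bar>\<sigma>\<bar> = 1" "\<bar>(1/3) ^ k * m k (x k)\<bar> \<le> \<bar>a (x k) + \<sigma> * ((1/3) ^ k * m k (x k))\<bar>"
      using sign by blast
    then show "\<exists>b. (Suc k = 0 \<longrightarrow> b = (\<lambda>y. 0)) \<and> Q k a b"
      by (intro exI[of _ "\<lambda>y. a y + \<sigma> * ((1/3) ^ k * m k y)"]) (auto simp: Q_def)
  qed simp
  then obtain S where S0: "S 0 = (\<lambda>y. 0)" and QS: "\<And>k. Q k (S k) (S (Suc k))"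
    by blast
  then have "\<forall>k. \<exists>\<sigma>::real. \<bar>\<sigma>\<bar> = 1 \<and> (\<forall>y. S (Suc k) y = S k y + \<sigma> * ((1/3) ^ k * m k y)) \<and>
      \<bar>(1/3) ^ k * m k (x k)\<bar> \<le> \<bar>S (Suc k) (x k)\<bar>"
    unfolding Q_def by blast
  from choice[OF this] obtain \<sigma> where \<sigma>: "\<And>k. \<bar>\<sigma> k\<bar> = (1::real)"
    and Suc: "\<And>k y. S (Suc k) y = S k y + \<sigma> k * ((1/3) ^ k * m k y)"
    and large: "\<And>k. \<bar>(1/3) ^ k * m k (x k)\<bar> \<le> \<bar>S (Suc k) (x k)\<bar>"
    by blast
  define g where "g y j = \<sigma> j * ((1/3) ^ j * m j y)" for y j
  have S: "S k y = (\<Sum>j<k. g y j)" for k y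
    by (induction k) (simp_all add: S0 Suc g_def)
  have g: "\<bar>g y j\<bar> \<le> p y * (1/3) ^ j" for y j
    using mp[of j y] \<sigma>[of j] by (simp add: g_def abs_mult mult.commute)
  have geo: "summable (\<lambda>j. p y * (1/3::real) ^ j)" for y
    by (intro summable_mult summable_geometric) simp
  have summ: "summable (g y)" for y
    by (rule summable_comparison_test'[OF geo[of y], of 0]) (use g in simp)
  define f where "f y = (\<Sum>j. g y j)" for y
  have tail: "\<bar>f y - S n y\<bar> \<le> p y * (1/3) ^ n * (3/2)" for y n
  proof -
    have "f y - S n y = (\<Sum>j. g y (j + n))"
      using suminf_split_initial_segment[OF summ[of y], of n] by (simp add: f_def S)
    moreover have "\<bar>\<Sum>j. g y (j + n)\<bar> \<le> (\<Sum>j. p y * (1/3) ^ n * (1/3) ^ j)"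
      unfolding real_norm_def[symmetric]
    proof (rule norm_suminf_le)
      show "norm (g y (j + n)) \<le> p y * (1/3) ^ n * (1/3) ^ j" for j
        using g[of y "j + n"] by (simp add: power_add mult_ac)
    qed (intro summable_mult summable_geometric, simp)
    moreover have "(\<Sum>j. p y * (1/3) ^ n * (1/3::real) ^ j) = p y * (1/3) ^ n * (3/2)"
      by (subst suminf_mult) (auto simp: suminf_geometric intro!: summable_geometric)
    ultimately show ?thesis by simp
  qed
  have flin: "linear f"
  proof (rule linearI)
    fix y z and r :: real
    show "f (y + z) = f y + f z"
    proof -
      have "g (y + z) = (\<lambda>j. g y j + g z j)"
        by (simp add: fun_eq_iff g_def linear_add[OF lin] algebra_simps)
      then show ?thesis using suminf_add[OF summ[of y] summ[of z]] by (simp add: f_def)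
    qed
    show "f (r *\<^sub>R y) = r *\<^sub>R f y"
    proof -
      have "g (r *\<^sub>R y) = (\<lambda>j. r * g y j)"
        by (simp add: fun_eq_iff g_def linear_scale[OF lin] algebra_simps)
      then show ?thesis using suminf_mult[OF summ[of y], of r] by (simp add: f_def)
    qed
  qed
  have "\<bar>f y\<bar> \<le> 3/2" if "y \<in> C" for y
    using tail[of y 0] minkowski_functional_le[of 1 y C] that by (simp add: S0 p_def)
  then have "continuous_on UNIV f"
    by (rule linear_continuous_lcs[OF flin C(2,3)])
  with flin weak obtain b where b: "\<And>y. y \<in> A \<Longrightarrow> \<bar>f y\<bar> \<le> b" by blast
  have lower: "(4/3) ^ k \<le> 2 * b" for k
  proof -
    have "p (x k) * (1/3) ^ k \<le> \<bar>S (Suc k) (x k)\<bar>"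
      using order_trans[OF abs_ge_self large[of k]] by (simp only: norming mult.commute)
    moreover have "\<bar>f (x k) - S (Suc k) (x k)\<bar> \<le> p (x k) * (1/3) ^ k / 2"
      using tail[of "x k" "Suc k"] by simp
    ultimately have "p (x k) * (1/3) ^ k \<le> 2 * \<bar>f (x k)\<bar>" by linarith
    moreover have "4 ^ k * (1/3) ^ k \<le> p (x k) * (1/3::real) ^ k"
      using big[of k] by (intro mult_right_mono) auto
    ultimately show ?thesis using b[OF x[of k]] by (simp add: power_divide)
  qed
  obtain k where "2 * b < (4/3) ^ k" using real_arch_pow[of "4/3" "2 * b"] by auto
  with lower[of k] show False by simp
qed

section \<open>Real-valued functions along curves\<close>

lemma mvt_from_zero:
  fixes g :: "real \<Rightarrow> real"
  assumes "\<And>s. \<bar>s\<bar> \<le> \<bar>t\<bar> \<Longrightarrow> (g has_real_derivative g' s) (at s)"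
  obtains s where "\<bar>s\<bar> \<le> \<bar>t\<bar>" "g t - g 0 = t * g' s"
proof (cases t "0 :: real" rule: linorder_cases)
  case less
  then obtain s where "t < s" "s < 0" "g 0 - g t = (0 - t) * g' s"
    using MVT2[of t 0 g g'] assms by auto
  then show ?thesis by (intro that[of s]) (auto simp: algebra_simps)
next
  case equal
  then show ?thesis by (intro that[of 0]) auto
next
  case greater
  then obtain s where "0 < s" "s < t" "g t - g 0 = (t - 0) * g' s"
    using MVT2[of 0 t g g'] assms by auto
  then show ?thesis by (intro that[of s]) auto
qed

lemma has_real_derivative_along_line:
  fixes f :: "'a::real_vector \<Rightarrow> real"
  assumes "has_dir_deriv f l (x + s *\<^sub>R v) v"
  shows "((\<lambda>r. f (x + r *\<^sub>R v)) has_real_derivative l) (at s)"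
  using assms unfolding has_dir_deriv_def DERIV_def
  by (simp add: algebra_simps divide_inverse_commute)

text \<open>Near \<open>0\<close> the quotient is close to its limit, and away from \<open>0\<close> the numerator is bounded by
  compactness. The bound holds on all of the interval given beforehand. This matters when the
  lemma is applied to \<open>f \<circ> g\<close> for all continuous linear functionals \<open>f\<close> at once: the interval
  does not depend on \<open>f\<close>, only the constant \<open>M\<close> does.\<close>

lemma difference_quotient_bounded:
  fixes h :: "real \<Rightarrow> real"
  assumes cont: "continuous_on {-d..d} h"
    and lim: "((\<lambda>t. (h t - h 0) /\<^sub>R t) \<longlongrightarrow> L) (at 0)"
  obtains M where "\<And>t. \<bar>t\<bar> \<le> d \<Longrightarrow> \<bar>h t - h 0\<bar> \<le> M * \<bar>t\<bar>"
proof -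
  have "\<forall>\<^sub>F t in at 0. dist ((h t - h 0) /\<^sub>R t) L < 1"
    using lim by (rule tendstoD) simp
  then obtain e where e: "e > 0" "\<And>t. t \<noteq> 0 \<Longrightarrow> \<bar>t\<bar> < e \<Longrightarrow> \<bar>(h t - h 0) / t - L\<bar> < 1"
    by (auto simp: eventually_at dist_real_def divide_inverse_commute)
  have "bounded (h ` {-d..d})"
    by (intro compact_imp_bounded compact_continuous_image cont) simp
  then obtain K where K: "\<And>t. \<bar>t\<bar> \<le> d \<Longrightarrow> \<bar>h t\<bar> \<le> K"
    by (force simp: bounded_iff abs_le_iff)
  show ?thesis
  proof (rule that[of "(\<bar>L\<bar> + 1) + 2 * \<bar>K\<bar> / e"])
    fix t :: real assume t: "\<bar>t\<bar> \<le> d"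
    show "\<bar>h t - h 0\<bar> \<le> ((\<bar>L\<bar> + 1) + 2 * \<bar>K\<bar> / e) * \<bar>t\<bar>"
    proof (cases "t = 0")
      case False
      have "\<bar>h t - h 0\<bar> \<le> (\<bar>L\<bar> + 1) * \<bar>t\<bar>" if "\<bar>t\<bar> < e"
      proof -
        have "\<bar>(h t - h 0) / t\<bar> \<le> \<bar>L\<bar> + 1" using e(2)[OF False that] by linarith
        then show ?thesis using False by (simp add: abs_divide divide_le_eq)
      qed
      moreover have "\<bar>h t - h 0\<bar> \<le> 2 * \<bar>K\<bar> / e * \<bar>t\<bar>" if "e \<le> \<bar>t\<bar>"
      proof -
        have "\<bar>h t - h 0\<bar> \<le> 2 * \<bar>K\<bar> * 1" using K[of t] K[of 0] t by linarith
        also have "\<dots> \<le> 2 * \<bar>K\<bar> * (\<bar>t\<bar> / e)"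
          using that e(1) by (intro mult_left_mono) auto
        finally show ?thesis by simp
      qed
      moreover have "0 \<le> (\<bar>L\<bar> + 1) * \<bar>t\<bar>" "0 \<le> 2 * \<bar>K\<bar> / e * \<bar>t\<bar>" using e(1) by simp_all
      ultimately show ?thesis unfolding distrib_right by (cases "\<bar>t\<bar> < e") linarith+
    qed simp
  qed
qed

lemma tendsto_line:
  fixes x v :: "'e::locally_convex_space"
  shows "((\<lambda>t. x + t *\<^sub>R v) \<longlongrightarrow> x + s *\<^sub>R v) (nhds s)"
  by (intro tendsto_intros tendsto_scaleR_lcs filterlim_ident)

lemma openin_subspace_line:
  fixes P :: "'e::locally_convex_space set"
  assumes "subspace P" "openin (top_of_set P) W" "x \<in> W" "v \<in> P"
  obtains d where "0 < d" "\<And>t. \<bar>t\<bar> \<le> d \<Longrightarrow> x + t *\<^sub>R v \<in> W"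
proof -
  obtain G where G: "open G" "W = P \<inter> G" using assms(2) by (auto simp: openin_open)
  have "\<forall>\<^sub>F t in nhds (0::real). x + t *\<^sub>R v \<in> G"
    using topological_tendstoD[OF tendsto_line[of x v 0] G(1)] assms(3) G(2) by simp
  then obtain d :: real where d: "d > 0" "\<And>t. \<bar>t\<bar> < d \<Longrightarrow> x + t *\<^sub>R v \<in> G"
    by (auto simp: eventually_nhds_metric dist_real_def)
  have "x + t *\<^sub>R v \<in> P" for t
    using assms G(2) by (intro subspace_add subspace_scale) auto
  then show ?thesis using d G(2) by (intro that[of "d / 2"]) auto
qed

lemma eventually_openin_subspace_line:
  fixes P :: "'e::locally_convex_space set"
  assumes "subspace P" "openin (top_of_set P) W" "x \<in> W" "v \<in> P"
  shows "\<forall>\<^sub>F t in at (0::real). x + t *\<^sub>R v \<in> W"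
proof -
  obtain d where "0 < d" "\<And>t. \<bar>t\<bar> \<le> d \<Longrightarrow> x + t *\<^sub>R v \<in> W"
    using openin_subspace_line[OF assms] by blast
  then show ?thesis by (auto simp: eventually_at dist_real_def intro!: exI[of _ d])
qed

text \<open>The heart of the chain rule. The curve is written as \<open>y + t *\<^sub>R u t\<close> with \<open>u t \<rightarrow> w\<close> as
  \<open>t \<rightarrow> 0\<close>. For fixed \<open>t\<close> the mean value theorem on the segment from \<open>y\<close> to \<open>y + t *\<^sub>R u t\<close>
  expresses the quotient as the derivative of \<open>f\<close> at a point \<open>y + s *\<^sub>R u t\<close>, \<open>\<bar>s\<bar> \<le> \<bar>t\<bar>\<close>, in
  direction \<open>u t\<close>, and the derivative is jointly continuous. The subspace \<open>P\<close>
  stands for a finite power \<open>E\<^sup>n\<close> inside the space of sequences.\<close>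

lemma dir_deriv_along_curve:
  fixes f :: "'e::locally_convex_space \<Rightarrow> real"
  assumes P: "subspace P" and W: "openin (top_of_set P) W"
    and ex: "\<And>x v. x \<in> W \<Longrightarrow> v \<in> P \<Longrightarrow> \<exists>l. has_dir_deriv f l x v"
    and cont: "continuous_on (W \<times> P) (\<lambda>(x, v). dir_deriv f x v)"
    and y: "y \<in> W" and u: "(u \<longlongrightarrow> w) (at (0::real))" and uP: "\<forall>\<^sub>F t in at 0. u t \<in> P"
    and w: "w \<in> P"
  shows "((\<lambda>t. (f (y + t *\<^sub>R u t) - f y) /\<^sub>R t) \<longlongrightarrow> dir_deriv f y w) (at 0)"
proof (rule tendstoI)
  fix e :: real assume "e > 0"
  define D where "D p = dir_deriv f (y + fst p *\<^sub>R snd p) (snd p)" for p :: "real \<times> 'e"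
  define R where "R = {p :: real \<times> 'e. snd p \<in> P \<and> y + fst p *\<^sub>R snd p \<in> W}"
  obtain G where G: "open G" "W = P \<inter> G" using W by (auto simp: openin_open)
  have line: "y + s *\<^sub>R v \<in> P" if "v \<in> P" for s v
    using that P y G by (intro subspace_add subspace_scale) auto
  have lim: "((\<lambda>p. y + fst p *\<^sub>R snd p) \<longlongrightarrow> y + fst q *\<^sub>R snd q) (nhds q)" for q :: "real \<times> 'e"
    by (intro tendsto_add tendsto_scaleR_lcs tendsto_const tendsto_fst tendsto_snd filterlim_ident)
  have "\<forall>\<^sub>F p in nhds (0, w). y + fst p *\<^sub>R snd p \<in> G"
    using topological_tendstoD[OF lim G(1), of "(0, w)"] y G(2) by simp
  moreover have "\<forall>\<^sub>F p in nhds (0, w). p \<in> R \<longrightarrow> dist (D p) (D (0, w)) < e"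
  proof -
    have "continuous_on R (\<lambda>p. y + fst p *\<^sub>R snd p)"
      unfolding continuous_on_def using lim tendsto_mono[OF at_within_le_nhds] by blast
    then have "continuous_on R (\<lambda>p. (y + fst p *\<^sub>R snd p, snd p))"
      by (intro continuous_on_Pair continuous_on_snd continuous_on_id)
    then have "continuous_on R D"
      using continuous_on_compose2[OF cont, of R "\<lambda>p. (y + fst p *\<^sub>R snd p, snd p)"]
      by (auto simp: D_def R_def)
    moreover have "(0, w) \<in> R" using y w by (simp add: R_def)
    ultimately have "(D \<longlongrightarrow> D (0, w)) (at (0, w) within R)" by (simp add: continuous_on_def)
    from tendstoD[OF this \<open>e > 0\<close>] show ?thesis
      unfolding eventually_at_filter by eventually_elim (use \<open>e > 0\<close> in auto)
  qed
  ultimately have "\<forall>\<^sub>F p in nhds 0 \<times>\<^sub>F nhds w. y + fst p *\<^sub>R snd p \<in> G \<and> (p \<in> R \<longrightarrow> dist (D p) (D (0, w)) < e)"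
    by (auto simp: nhds_prod[symmetric] intro: eventually_conj)
  then obtain A B where A: "eventually A (nhds (0::real))" and B: "eventually B (nhds w)"
    and AB: "\<And>s v. A s \<Longrightarrow> B v \<Longrightarrow> y + s *\<^sub>R v \<in> G \<and> ((s, v) \<in> R \<longrightarrow> dist (D (s, v)) (D (0, w)) < e)"
    by (auto simp: eventually_prod_filter)
  obtain d where d: "d > 0" "\<And>s. \<bar>s\<bar> < d \<Longrightarrow> A s"
    using A by (auto simp: eventually_nhds_metric dist_real_def)
  have "\<forall>\<^sub>F t in at (0::real). B (u t)" using B u by (rule eventually_compose_filterlim)
  moreover have "\<forall>\<^sub>F t in at (0::real). t \<noteq> 0 \<and> \<bar>t\<bar> < d"
    using d(1) by (auto simp: eventually_at dist_real_def)
  ultimately show "\<forall>\<^sub>F t in at 0. dist ((f (y + t *\<^sub>R u t) - f y) /\<^sub>R t) (dir_deriv f y w) < e"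
    using uP
  proof eventually_elim
    case (elim t)
    have R: "(s, u t) \<in> R" "dist (D (s, u t)) (D (0, w)) < e" if "\<bar>s\<bar> \<le> \<bar>t\<bar>" for s
      using AB[OF d(2), of s "u t"] elim that line[of "u t" s] G(2) by (auto simp: R_def)
    have "((\<lambda>r. f (y + r *\<^sub>R u t)) has_real_derivative D (s, u t)) (at s)" if s: "\<bar>s\<bar> \<le> \<bar>t\<bar>" for s
    proof (rule has_real_derivative_along_line)
      obtain l where "has_dir_deriv f l (y + s *\<^sub>R u t) (u t)"
        using ex R(1)[OF s] by (auto simp: R_def)
      then show "has_dir_deriv f (D (s, u t)) (y + s *\<^sub>R u t) (u t)"
        by (simp add: D_def dir_deriv_eq)
    qed
    then obtain s where "\<bar>s\<bar> \<le> \<bar>t\<bar>" "f (y + t *\<^sub>R u t) - f (y + 0 *\<^sub>R u t) = t * D (s, u t)"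
      by (rule mvt_from_zero)
    then show ?case using R(2)[of s] elim by (simp add: D_def mult.assoc[symmetric])
  qed
qed

section \<open>Tangent maps on finite powers\<close>

lemma fst_half_power_space: "fst_half m z \<in> power_space m"
  by (simp add: fst_half_def power_space_def)

lemma snd_half_power_space: "z \<in> power_space (2 * m) \<Longrightarrow> snd_half m z \<in> power_space m"
  by (simp add: snd_half_def power_space_def)

lemma linear_fst_half: "linear (fst_half m)"
  by (rule linearI) (auto simp: fst_half_def fun_eq_iff)

lemma linear_snd_half: "linear (snd_half m)"
  by (rule linearI) (auto simp: snd_half_def fun_eq_iff)

lemma continuous_on_fst_half:
  "continuous_on S (fst_half m :: (nat \<Rightarrow> 'a::{zero,topological_space}) \<Rightarrow> _)"
proof (rule continuous_on_coordinatewise_then_product)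
  fix i show "continuous_on S (\<lambda>z :: nat \<Rightarrow> 'a. fst_half m z i)"
    by (cases "i < m") (auto simp: fst_half_def intro: continuous_on_coord[OF continuous_on_id])
qed

lemma continuous_on_snd_half:
  "continuous_on S (snd_half m :: (nat \<Rightarrow> 'a::topological_space) \<Rightarrow> _)"
  by (rule continuous_on_coordinatewise_then_product)
     (auto simp: snd_half_def intro: continuous_on_coord[OF continuous_on_id])

text \<open>The concatenation \<open>E\<^sup>m \<times> E\<^sup>m \<rightarrow> E\<^sup>2\<^sup>m\<close>, inverse to the pair of \<open>fst_half m\<close> and \<open>snd_half m\<close>.\<close>

definition join_halves :: "nat \<Rightarrow> (nat \<Rightarrow> 'a) \<Rightarrow> (nat \<Rightarrow> 'a) \<Rightarrow> nat \<Rightarrow> 'a"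
  where "join_halves m x v = (\<lambda>i. if i < m then x i else v (i - m))"

lemma fst_half_join: "x \<in> power_space m \<Longrightarrow> fst_half m (join_halves m x v) = x"
  by (auto simp: fst_half_def join_halves_def power_space_def fun_eq_iff)

lemma snd_half_join [simp]: "snd_half m (join_halves m x v) = v"
  by (simp add: snd_half_def join_halves_def fun_eq_iff)

lemma join_halves_power_space:
  "v \<in> power_space m \<Longrightarrow> join_halves m x v \<in> power_space (2 * m)"
  by (auto simp: join_halves_def power_space_def)

lemma continuous_on_join_halves:
  fixes f g :: "'c::topological_space \<Rightarrow> nat \<Rightarrow> 'a::topological_space"
  assumes "continuous_on S f" "continuous_on S g"
  shows "continuous_on S (\<lambda>x. join_halves m (f x) (g x))"
proof (rule continuous_on_coordinatewise_then_product)
  fix i show "continuous_on S (\<lambda>x. join_halves m (f x) (g x) i)"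
    using assms by (cases "i < m") (auto simp: join_halves_def intro: continuous_on_coord)
qed

lemma linear_join_halves:
  assumes "linear f" "linear g"
  shows "linear (\<lambda>x. join_halves m (f x) (g x))"
  by (rule linearI)
     (auto simp: join_halves_def fun_eq_iff linear_add[OF assms(1)] linear_add[OF assms(2)]
       linear_scale[OF assms(1)] linear_scale[OF assms(2)])

lemma openin_tangent_dom:
  fixes W :: "(nat \<Rightarrow> 'a::{zero,topological_space}) set"
  assumes "openin (top_of_set (power_space m)) W"
  shows "openin (top_of_set (power_space (2 * m))) (tangent_dom m W)"
proof -
  obtain G where G: "open G" "W = power_space m \<inter> G" using assms by (auto simp: openin_open)
  have "tangent_dom m W = power_space (2 * m) \<inter> fst_half m -` G"
    using G(2) fst_half_power_space by (auto simp: tangent_dom_def)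
  moreover have "open (fst_half m -` G)"
    by (rule open_vimage[OF G(1) continuous_on_fst_half])
  ultimately show ?thesis by (auto simp: openin_open)
qed

lemma continuous_on_dir_deriv_pair:
  fixes f :: "(nat \<Rightarrow> 'a::{real_vector,topological_space}) \<Rightarrow> 'b::{real_vector,topological_space}"
  assumes "W \<subseteq> power_space m" "continuous_on (tangent_dom m W) (tangent_map m f)"
  shows "continuous_on (W \<times> power_space m) (\<lambda>(x, v). dir_deriv f x v)"
proof -
  have "continuous_on (W \<times> power_space m) (\<lambda>p. tangent_map m f (join_halves m (fst p) (snd p)))"
  proof (rule continuous_on_compose2[OF assms(2)])
    show "continuous_on (W \<times> power_space m) (\<lambda>p. join_halves m (fst p) (snd p))"
      by (intro continuous_on_join_halves continuous_intros)
    show "(\<lambda>p. join_halves m (fst p) (snd p)) ` (W \<times> power_space m) \<subseteq> tangent_dom m W"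
      using assms(1) by (auto simp: tangent_dom_def fst_half_join join_halves_power_space)
  qed
  then show ?thesis
    by (rule continuous_on_cong[THEN iffD1, rotated -1])
       (use assms(1) in \<open>auto simp: tangent_map_def fst_half_join\<close>)
qed

lemma Ck_power_continuous: "Ck_power k m W f \<Longrightarrow> continuous_on W f"
  by (cases k) auto

lemma Ck_power_SucD: "Ck_power (Suc k) m W f \<Longrightarrow> Ck_power k m W f"
  by (induction k arbitrary: m W f) auto

lemma has_dir_deriv_cong_on:
  fixes f g :: "'e::locally_convex_space \<Rightarrow> 'b::{real_vector,topological_space}"
  assumes "subspace P" "openin (top_of_set P) W" "x \<in> W" "v \<in> P" "\<And>x. x \<in> W \<Longrightarrow> f x = g x"
  shows "has_dir_deriv f l x v \<longleftrightarrow> has_dir_deriv g l x v"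
  unfolding has_dir_deriv_def
  by (rule tendsto_cong, rule eventually_mono[OF eventually_openin_subspace_line[OF assms(1-4)]])
     (use assms(3,5) in simp)

text \<open>The derivatives at a point of \<open>W\<close> only see \<open>f\<close> on \<open>W\<close>, as \<open>W\<close> is relatively open.\<close>

lemma Ck_power_cong:
  fixes W :: "(nat \<Rightarrow> 'a::locally_convex_space) set"
  assumes "openin (top_of_set (power_space m)) W" "\<And>x. x \<in> W \<Longrightarrow> f x = g x"
  shows "Ck_power k m W f \<longleftrightarrow> Ck_power k m W g"
  using assms
proof (induction k arbitrary: m W f g)
  case 0
  then show ?case by (simp cong: continuous_on_cong)
next
  case (Suc k)
  have eq: "has_dir_deriv f l x v \<longleftrightarrow> has_dir_deriv g l x v" if "x \<in> W" "v \<in> power_space m" for l x v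
    by (rule has_dir_deriv_cong_on[OF subspace_power_space Suc.prems(1) that Suc.prems(2)])
  have tan: "tangent_map m f z = tangent_map m g z" if "z \<in> tangent_dom m W" for z
  proof -
    have "fst_half m z \<in> W" "snd_half m z \<in> power_space m"
      using that snd_half_power_space by (auto simp: tangent_dom_def)
    then show ?thesis by (simp add: tangent_map_def dir_deriv_def eq)
  qed
  have "Ck_power k (2 * m) (tangent_dom m W) (tangent_map m f) \<longleftrightarrow>
      Ck_power k (2 * m) (tangent_dom m W) (tangent_map m g)"
    by (rule Suc.IH[OF openin_tangent_dom[OF Suc.prems(1)] tan])
  moreover have "continuous_on (tangent_dom m W) (tangent_map m f) \<longleftrightarrow>
      continuous_on (tangent_dom m W) (tangent_map m g)"
    using tan by (intro continuous_on_cong) auto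
  moreover have "continuous_on W f \<longleftrightarrow> continuous_on W g"
    using Suc.prems by (intro continuous_on_cong) auto
  ultimately show ?case using eq by simp
qed

lemma has_dir_deriv_linear:
  assumes "linear L"
  shows "has_dir_deriv L (L v) x v"
  unfolding has_dir_deriv_def
  by (rule tendsto_eventually) (auto simp: linear_add[OF assms] linear_scale[OF assms] eventually_at intro!: exI[of _ 1])

lemma Ck_power_linear:
  fixes L :: "(nat \<Rightarrow> 'a::locally_convex_space) \<Rightarrow> 'b::locally_convex_space"
  assumes "linear L" "continuous_on UNIV L"
  shows "Ck_power k m W L"
  using assms
proof (induction k arbitrary: m W L)
  case 0
  then show ?case by (auto intro: continuous_on_subset)
next
  case (Suc k)
  have "tangent_map m L = (\<lambda>z. L (snd_half m z))"
    by (simp add: fun_eq_iff tangent_map_def dir_deriv_eq[OF has_dir_deriv_linear[OF Suc.prems(1)]])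
  moreover have "linear (\<lambda>z. L (snd_half m z))"
    using linear_compose[OF linear_snd_half Suc.prems(1)] by (simp add: o_def)
  moreover have "continuous_on S (\<lambda>z. L (snd_half m z))" for S
    by (rule continuous_on_compose2[OF Suc.prems(2) continuous_on_snd_half]) simp
  ultimately show ?case
    using Suc has_dir_deriv_linear[OF Suc.prems(1)] unfolding Ck_power.simps
    by (metis continuous_on_subset subset_UNIV)
qed

text \<open>The tangent map of \<open>f \<circ> L\<close> is the tangent map of \<open>f\<close> composed with \<open>L\<close> acting on both halves,
  which is again linear and continuous; so the induction stays within the statement.\<close>

lemma Ck_power_compose_linear:
  fixes L :: "(nat \<Rightarrow> 'c::locally_convex_space) \<Rightarrow> nat \<Rightarrow> 'a::locally_convex_space"
    and f :: "(nat \<Rightarrow> 'a) \<Rightarrow> 'b::locally_convex_space"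
  assumes "linear L" "continuous_on UNIV L" "\<And>x. x \<in> power_space n \<Longrightarrow> L x \<in> power_space m"
    and "Ck_power k m W f"
  shows "Ck_power k n {x \<in> power_space n. L x \<in> W} (\<lambda>x. f (L x))"
  using assms
proof (induction k arbitrary: m n W f L)
  case 0
  then show ?case
    by (auto intro: continuous_on_compose2[of W f] continuous_on_subset)
next
  case (Suc k)
  let ?T = "\<lambda>z. join_halves m (L (fst_half n z)) (L (snd_half n z))"
  let ?V = "{x \<in> power_space n. L x \<in> W}"
  have hd: "has_dir_deriv (\<lambda>x. f (L x)) l x v \<longleftrightarrow> has_dir_deriv f l (L x) (L v)" for l x v
    by (rule has_dir_deriv_cong) (simp only: linear_add[OF Suc.prems(1)] linear_scale[OF Suc.prems(1)])
  have fst: "fst_half m (?T z) = L (fst_half n z)" for z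
    by (intro fst_half_join Suc.prems(3) fst_half_power_space)
  have map: "tangent_map n (\<lambda>x. f (L x)) = (\<lambda>z. tangent_map m f (?T z))"
    by (simp add: fun_eq_iff tangent_map_def dir_deriv_def hd fst)
  have pow: "?T z \<in> power_space (2 * m)" if "z \<in> power_space (2 * n)" for z
    by (intro join_halves_power_space Suc.prems(3) snd_half_power_space that)
  have dom: "tangent_dom n ?V = {z \<in> power_space (2 * n). ?T z \<in> tangent_dom m W}"
    using pow by (auto simp: tangent_dom_def fst fst_half_power_space)
  have lin: "linear ?T"
    using linear_compose[OF linear_fst_half Suc.prems(1)] linear_compose[OF linear_snd_half Suc.prems(1)]
    by (intro linear_join_halves) (simp_all add: o_def)
  have cont: "continuous_on UNIV ?T"
    by (intro continuous_on_join_halves continuous_on_compose2[OF Suc.prems(2)]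
        continuous_on_fst_half continuous_on_snd_half) auto
  have rec: "Ck_power j (2 * n) (tangent_dom n ?V) (tangent_map n (\<lambda>x. f (L x)))"
    if "Ck_power j (2 * m) (tangent_dom m W) (tangent_map m f)" "j = k" for j
    unfolding map dom using Suc.IH[OF lin cont pow] that by blast
  have "Ck_power k (2 * n) (tangent_dom n ?V) (tangent_map n (\<lambda>x. f (L x)))"
    using rec Suc.prems(4) by simp
  moreover have "continuous_on ?V (\<lambda>x. f (L x))"
    by (rule continuous_on_compose2[of W f])
       (use Suc.prems Ck_power_continuous in \<open>auto intro: continuous_on_subset\<close>)
  ultimately show ?case
    using Suc.prems(3,4) by (auto simp: hd dest: Ck_power_continuous)
qed

lemma has_dir_deriv_componentwise:
  fixes f :: "'e::real_vector \<Rightarrow> nat \<Rightarrow> 'b::locally_convex_space"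
  shows "has_dir_deriv f l x v \<longleftrightarrow> (\<forall>i. has_dir_deriv (\<lambda>x. f x i) (l i) x v)"
  by (simp add: has_dir_deriv_def tendsto_fun_iff)

text \<open>The chain rule for real-valued \<open>f\<close>. Writing \<open>T\<close> for the map \<open>(x, v) \<mapsto> (\<Phi> x, d\<Phi>\<^sub>x v)\<close> into \<open>F\<^sup>2\<^sup>n\<close>, the
  tangent map of \<open>f \<circ> \<Phi>\<close> is that of \<open>f\<close> composed with \<open>T\<close>, and \<open>T\<close> is of class \<open>C\<^sup>k\<close> if \<open>\<Phi>\<close> is of class
  \<open>C\<^sup>k\<^sup>+\<^sup>1\<close>. Regularity of \<open>\<Phi>\<close> is required of its coordinates, so that the coordinates of \<open>T\<close>
  can be treated separately.\<close>

theorem Ck_power_compose: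
  fixes f :: "(nat \<Rightarrow> 'b::locally_convex_space) \<Rightarrow> real"
    and \<Phi> :: "(nat \<Rightarrow> 'a::locally_convex_space) \<Rightarrow> nat \<Rightarrow> 'b"
  assumes "openin (top_of_set (power_space m)) W" "openin (top_of_set (power_space n)) V"
    and "\<Phi> ` W \<subseteq> V"
    and "\<And>i. Ck_power k m W (\<lambda>x. \<Phi> x i)" "Ck_power k n V f"
  shows "Ck_power k m W (\<lambda>x. f (\<Phi> x))"
  using assms
proof (induction k arbitrary: m n W V f \<Phi>)
  case 0
  have "continuous_on W \<Phi>"
    using 0(4) by (intro continuous_on_coordinatewise_then_product) simp
  then show ?case using 0 by (auto intro: continuous_on_compose2[of V f])
next
  case (Suc k)
  note W = Suc.prems(1) and V = Suc.prems(2)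
  have WP: "W \<subseteq> power_space m" and VP: "V \<subseteq> power_space n"
    using W V by (auto dest: openin_imp_subset)
  define T where "T z = join_halves n (\<Phi> (fst_half m z)) (\<lambda>i. tangent_map m (\<lambda>x. \<Phi> x i) z)" for z
  have \<Phi>d: "has_dir_deriv \<Phi> (\<lambda>i. dir_deriv (\<lambda>x. \<Phi> x i) x v) x v"
    if "x \<in> W" "v \<in> power_space m" for x v
    unfolding has_dir_deriv_componentwise
  proof
    fix i
    obtain l where "has_dir_deriv (\<lambda>x. \<Phi> x i) l x v" using Suc.prems(4)[of i] \<open>x \<in> W\<close> \<open>v \<in> _\<close> by auto
    then show "has_dir_deriv (\<lambda>x. \<Phi> x i) (dir_deriv (\<lambda>x. \<Phi> x i) x v) x v" by (simp add: dir_deriv_eq)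
  qed
  have step: "\<forall>\<^sub>F t in at 0. (\<Phi> (x + t *\<^sub>R v) - \<Phi> x) /\<^sub>R t \<in> power_space n"
    if "x \<in> W" "v \<in> power_space m" for x v
    using eventually_openin_subspace_line[OF subspace_power_space W that]
  proof eventually_elim
    case (elim t)
    then have "\<Phi> (x + t *\<^sub>R v) \<in> power_space n" "\<Phi> x \<in> power_space n"
      using Suc.prems(3) VP that by auto
    then show ?case by (intro subspace_scale subspace_diff subspace_power_space)
  qed
  have \<Phi>dP: "(\<lambda>i. dir_deriv (\<lambda>x. \<Phi> x i) x v) \<in> power_space n"
    if "x \<in> W" "v \<in> power_space m" for x v
    by (rule Lim_in_closed_set[OF closed_power_space step[OF that] _ \<Phi>d[OF that, unfolded has_dir_deriv_def]]) simp
  have fcont: "continuous_on (V \<times> power_space n) (\<lambda>(x, v). dir_deriv f x v)"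
    using Suc.prems(5) by (intro continuous_on_dir_deriv_pair VP) simp
  have chain: "has_dir_deriv (\<lambda>x. f (\<Phi> x)) (dir_deriv f (\<Phi> x) (\<lambda>i. dir_deriv (\<lambda>x. \<Phi> x i) x v)) x v"
    if "x \<in> W" "v \<in> power_space m" for x v
  proof -
    have "\<Phi> x \<in> V" using Suc.prems(3) that by auto
    from dir_deriv_along_curve[OF subspace_power_space V _ fcont this
        \<Phi>d[OF that, unfolded has_dir_deriv_def] step[OF that] \<Phi>dP[OF that]]
    have "((\<lambda>t. (f (\<Phi> x + t *\<^sub>R ((\<Phi> (x + t *\<^sub>R v) - \<Phi> x) /\<^sub>R t)) - f (\<Phi> x)) /\<^sub>R t) \<longlongrightarrow>
        dir_deriv f (\<Phi> x) (\<lambda>i. dir_deriv (\<lambda>x. \<Phi> x i) x v)) (at 0)"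
      using Suc.prems(5) by simp
    then show ?thesis
      unfolding has_dir_deriv_def
      by (rule Lim_transform_eventually) (auto simp: eventually_at intro!: exI[of _ 1])
  qed
  have fstT: "fst_half n (T z) = \<Phi> (fst_half m z)" if "z \<in> tangent_dom m W" for z
    unfolding T_def by (rule fst_half_join) (use that Suc.prems(3) VP in \<open>auto simp: tangent_dom_def\<close>)
  have map: "tangent_map m (\<lambda>x. f (\<Phi> x)) z = tangent_map n f (T z)" if "z \<in> tangent_dom m W" for z
  proof -
    have z: "fst_half m z \<in> W" "snd_half m z \<in> power_space m"
      using that snd_half_power_space by (auto simp: tangent_dom_def)
    have "snd_half n (T z) = (\<lambda>i. dir_deriv (\<lambda>x. \<Phi> x i) (fst_half m z) (snd_half m z))"
      by (simp add: T_def tangent_map_def)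
    then show ?thesis
      unfolding tangent_map_def[of m "\<lambda>x. f (\<Phi> x)"] tangent_map_def[of n f] fstT[OF that]
      by (simp add: dir_deriv_eq[OF chain[OF z]])
  qed
  have sub: "T ` tangent_dom m W \<subseteq> tangent_dom n V"
  proof
    fix y assume "y \<in> T ` tangent_dom m W"
    then obtain z where z: "z \<in> tangent_dom m W" "y = T z" by blast
    have "fst_half m z \<in> W" "snd_half m z \<in> power_space m"
      using z(1) snd_half_power_space by (auto simp: tangent_dom_def)
    then show "y \<in> tangent_dom n V"
      using \<Phi>dP Suc.prems(3) fstT[OF z(1)] unfolding z(2)
      by (auto simp: tangent_dom_def T_def tangent_map_def intro!: join_halves_power_space)
  qed
  have comp: "Ck_power k (2 * m) (tangent_dom m W) (\<lambda>z. T z i)" for i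
  proof (cases "i < n")
    case True
    have "Ck_power k (2 * m) {z \<in> power_space (2 * m). fst_half m z \<in> W} (\<lambda>z. \<Phi> (fst_half m z) i)"
      by (rule Ck_power_compose_linear[OF linear_fst_half continuous_on_fst_half fst_half_power_space])
         (rule Ck_power_SucD[OF Suc.prems(4)])
    then show ?thesis using True by (simp add: T_def join_halves_def tangent_dom_def)
  next
    case False
    then show ?thesis using Suc.prems(4)[of "i - n"] by (simp add: T_def join_halves_def)
  qed
  have "Ck_power k (2 * m) (tangent_dom m W) (\<lambda>z. tangent_map n f (T z))"
    using Suc.prems(5) by (intro Suc.IH[OF openin_tangent_dom[OF W] openin_tangent_dom[OF V] sub comp]) simp
  then have rec: "Ck_power k (2 * m) (tangent_dom m W) (tangent_map m (\<lambda>x. f (\<Phi> x)))"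
    by (subst Ck_power_cong[OF openin_tangent_dom[OF W] map])
  have "continuous_on W \<Phi>"
    using Suc.prems(4) by (intro continuous_on_coordinatewise_then_product) simp
  then have "continuous_on W (\<lambda>x. f (\<Phi> x))"
    using Suc.prems(3,5) by (auto intro: continuous_on_compose2[of V f])
  then show ?case
    using chain rec Ck_power_continuous[OF rec] unfolding Ck_power.simps by blast
qed

section \<open>Weak smoothness implies smoothness\<close>

lemma tvs_bounded_small_multiples:
  fixes A :: "'a::locally_convex_space set"
  assumes "tvs_bounded A" "open N" "0 \<in> N"
  obtains d where "0 < d" "\<And>t a. \<bar>t\<bar> < d \<Longrightarrow> a \<in> A \<Longrightarrow> t *\<^sub>R a \<in> N"
proof -
  obtain C where C: "convex C" "open C" "0 \<in> C" "C \<subseteq> N" "\<And>x. x \<in> C \<Longrightarrow> - x \<in> C"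
    using symmetric_convex_neighbourhood[OF assms(2,3)] by blast
  obtain r where r: "0 < r" "A \<subseteq> (*\<^sub>R) r ` C"
    using assms(1) C(2,3) unfolding tvs_bounded_def by blast
  show ?thesis
  proof (rule that[of "1 / r"])
    fix t :: real and a assume t: "\<bar>t\<bar> < 1 / r" and "a \<in> A"
    then obtain c where c: "c \<in> C" "a = r *\<^sub>R c" using r(2) by blast
    have small: "\<bar>t\<bar> * r \<le> 1" using t r(1) by (simp add: field_simps)
    have "t *\<^sub>R a \<in> C"
    proof (cases "0 \<le> t")
      case True
      then have "(t * r) *\<^sub>R c \<in> C" using small r(1) by (intro convex_scale_mem[OF C(1,3) c(1)]) auto
      then show ?thesis by (simp add: c(2))
    next
      case False
      then have "(- t * r) *\<^sub>R (- c) \<in> C"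
        using small r(1) by (intro convex_scale_mem[OF C(1,3) C(5)[OF c(1)]]) (auto simp: mult_le_0_iff)
      then show ?thesis by (simp add: c(2))
    qed
    then show "t *\<^sub>R a \<in> N" using C(4) by blast
  qed (use r(1) in simp)
qed

text \<open>For each continuous linear \<open>f\<close> the numbers \<open>f (q s - q t) / (\<bar>s\<bar> + \<bar>t\<bar>)\<close> are bounded. The set of
  all vectors obeying the same bounds \<open>M f\<close> is absolutely convex, and it is bounded because weakly bounded
  sets are. So \<open>q\<close> is a Mackey--Cauchy net, indexed by the punctured interval, where indices
  closer to \<open>0\<close> are larger.\<close>

lemma mackey_complete_limit_at_0:
  fixes q :: "real \<Rightarrow> 'b::locally_convex_space"
  assumes mc: "mackey_complete TYPE('b)" and d: "0 < d"
    and weak: "\<And>f :: 'b \<Rightarrow> real. linear f \<Longrightarrow> continuous_on UNIV f \<Longrightarrow>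
      \<exists>M. \<forall>s t. s \<noteq> 0 \<longrightarrow> \<bar>s\<bar> \<le> d \<longrightarrow> t \<noteq> 0 \<longrightarrow> \<bar>t\<bar> \<le> d \<longrightarrow> \<bar>f (q s - q t)\<bar> \<le> M * (\<bar>s\<bar> + \<bar>t\<bar>)"
  obtains l where "(q \<longlongrightarrow> l) (at 0)"
proof -
  have "\<forall>f. \<exists>M. linear f \<and> continuous_on UNIV f \<longrightarrow>
      (\<forall>s t. s \<noteq> 0 \<longrightarrow> \<bar>s\<bar> \<le> d \<longrightarrow> t \<noteq> 0 \<longrightarrow> \<bar>t\<bar> \<le> d \<longrightarrow> \<bar>f (q s - q t)\<bar> \<le> M * (\<bar>s\<bar> + \<bar>t\<bar>))"
    using weak by blast
  from choice[OF this] obtain M :: "('b \<Rightarrow> real) \<Rightarrow> real" where M: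
    "\<And>f s t. linear f \<Longrightarrow> continuous_on UNIV f \<Longrightarrow> s \<noteq> 0 \<Longrightarrow> \<bar>s\<bar> \<le> d \<Longrightarrow> t \<noteq> 0 \<Longrightarrow> \<bar>t\<bar> \<le> d \<Longrightarrow>
      \<bar>f (q s - q t)\<bar> \<le> M f * (\<bar>s\<bar> + \<bar>t\<bar>)"
    by blast
  define B where "B = {y. \<forall>f. linear f \<and> continuous_on UNIV f \<longrightarrow> \<bar>f y\<bar> \<le> \<bar>M f\<bar>}"
  have "absolutely_convex B"
    unfolding absolutely_convex_def
  proof (intro ballI allI impI)
    fix x y and a b :: real assume xy: "x \<in> B" "y \<in> B" and ab: "\<bar>a\<bar> + \<bar>b\<bar> \<le> 1"
    show "a *\<^sub>R x + b *\<^sub>R y \<in> B"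
      unfolding B_def
    proof (intro CollectI allI impI)
      fix f :: "'b \<Rightarrow> real" assume f: "linear f \<and> continuous_on UNIV f"
      have "\<bar>f (a *\<^sub>R x + b *\<^sub>R y)\<bar> \<le> \<bar>a\<bar> * \<bar>f x\<bar> + \<bar>b\<bar> * \<bar>f y\<bar>"
        using f by (simp add: linear_add linear_scale abs_mult[symmetric] abs_triangle_ineq)
      also have "\<dots> \<le> \<bar>a\<bar> * \<bar>M f\<bar> + \<bar>b\<bar> * \<bar>M f\<bar>"
        using xy f by (intro add_mono mult_left_mono) (auto simp: B_def)
      also have "\<dots> \<le> 1 * \<bar>M f\<bar>"
        unfolding distrib_right[symmetric] using ab by (intro mult_right_mono) auto
      finally show "\<bar>f (a *\<^sub>R x + b *\<^sub>R y)\<bar> \<le> \<bar>M f\<bar>" by simp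
    qed
  qed
  moreover have "tvs_bounded B"
    by (rule weakly_bounded_imp_bounded) (auto simp: B_def)
  moreover define I where "I = {t :: real. t \<noteq> 0 \<and> \<bar>t\<bar> \<le> d}"
  moreover define R where "R s t \<longleftrightarrow> \<bar>t\<bar> \<le> \<bar>s\<bar>" for s t :: real
  have dir: "directed_set I R"
    unfolding directed_set_def
  proof (intro conjI ballI)
    show "I \<noteq> {}" using d by (auto simp: I_def intro!: exI[of _ d])
    fix i j assume "i \<in> I" "j \<in> I"
    then show "\<exists>k\<in>I. R i k \<and> R j k"
      by (cases "\<bar>i\<bar> \<le> \<bar>j\<bar>")
         (auto simp: R_def intro: bexI[of _ i] bexI[of _ j])
  qed (auto simp: R_def)
  have abs0: "((\<lambda>i. \<bar>i\<bar>) \<longlongrightarrow> 0) (tails I R)"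
  proof (rule tendstoI)
    fix e :: real assume "e > 0"
    then show "\<forall>\<^sub>F i in tails I R. dist \<bar>i\<bar> 0 < e"
      unfolding eventually_tails[OF dir] using d
      by (intro bexI[of _ "min d (e / 2)"]) (auto simp: R_def I_def)
  qed
  have "((\<lambda>p. \<bar>fst p\<bar> + \<bar>snd p\<bar>) \<longlongrightarrow> 0 + 0) (tails I R \<times>\<^sub>F tails I R)"
    by (intro tendsto_add filterlim_compose[OF abs0] filterlim_fst filterlim_snd)
  then have "((\<lambda>(i, j). \<bar>i\<bar> + \<bar>j\<bar>) \<longlongrightarrow> 0) (tails I R \<times>\<^sub>F tails I R)"
    by (simp add: case_prod_unfold)
  moreover have "q s - q t \<in> (*\<^sub>R) (\<bar>s\<bar> + \<bar>t\<bar>) ` B" if "s \<in> I" "t \<in> I" for s t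
  proof -
    let ?r = "\<bar>s\<bar> + \<bar>t\<bar>"
    have r: "0 < ?r" using that by (auto simp: I_def)
    have "(1 / ?r) *\<^sub>R (q s - q t) \<in> B"
      unfolding B_def
    proof (intro CollectI allI impI)
      fix f :: "'b \<Rightarrow> real" assume f: "linear f \<and> continuous_on UNIV f"
      have "\<bar>f (q s - q t)\<bar> \<le> M f * ?r" using M[of f s t] f that by (auto simp: I_def)
      also have "\<dots> \<le> \<bar>M f\<bar> * ?r" using r by (intro mult_right_mono) auto
      finally show "\<bar>f ((1 / ?r) *\<^sub>R (q s - q t))\<bar> \<le> \<bar>M f\<bar>"
        using f r by (simp add: linear_scale abs_mult divide_le_eq)
    qed
    moreover have "q s - q t = ?r *\<^sub>R ((1 / ?r) *\<^sub>R (q s - q t))" using r by simp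
    ultimately show ?thesis by (rule rev_image_eqI)
  qed
  ultimately have "mackey_cauchy I R q"
    unfolding mackey_cauchy_def by blast
  then obtain l where l: "(q \<longlongrightarrow> l) (tails I R)"
    using mackey_complete_net[OF mc dir] by blast
  have "(q \<longlongrightarrow> l) (at 0)"
  proof (rule topological_tendstoI)
    fix S assume "open S" "l \<in> S"
    then have "\<forall>\<^sub>F t in tails I R. q t \<in> S" using l by (rule topological_tendstoD[rotated])
    then obtain i where i: "i \<in> I" "\<And>t. t \<in> I \<Longrightarrow> R i t \<Longrightarrow> q t \<in> S"
      unfolding eventually_tails[OF dir] by blast
    then show "\<forall>\<^sub>F t in at 0. q t \<in> S"
      by (auto simp: eventually_at dist_real_def I_def R_def intro!: exI[of _ "\<bar>i\<bar>"])
  qed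
  then show ?thesis by (rule that)
qed

text \<open>For a real function of class \<open>C\<^sup>2\<close> near \<open>0\<close>, the difference quotient between \<open>0\<close> and \<open>t\<close> deviates
  from the derivative at \<open>0\<close> by at most a multiple of \<open>\<bar>t\<bar>\<close>. Applied to all \<open>f \<circ> \<Psi>\<close>, this is exactly the weak
  estimate that makes the difference quotients of \<open>\<Psi>\<close> converge by Mackey completeness.\<close>

lemma weakly_C2_has_dir_deriv:
  fixes \<Psi> :: "(nat \<Rightarrow> 'a::locally_convex_space) \<Rightarrow> 'b::locally_convex_space"
  assumes mc: "mackey_complete TYPE('b)" and W: "openin (top_of_set (power_space m)) W"
    and weak: "\<And>f :: 'b \<Rightarrow> real. linear f \<Longrightarrow> continuous_on UNIV f \<Longrightarrow> Ck_power 2 m W (\<lambda>x. f (\<Psi> x))"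
    and x: "x \<in> W" and v: "v \<in> power_space m"
  shows "\<exists>l. has_dir_deriv \<Psi> l x v"
proof -
  obtain d where d: "0 < d" "\<And>t. \<bar>t\<bar> \<le> d \<Longrightarrow> x + t *\<^sub>R v \<in> W"
    using openin_subspace_line[OF subspace_power_space W x v] by blast
  have xP: "x + t *\<^sub>R v \<in> power_space m" for t
    using x v openin_imp_subset[OF W]
    by (intro subspace_add subspace_scale subspace_power_space) auto
  define q where "q t = (\<Psi> (x + t *\<^sub>R v) - \<Psi> x) /\<^sub>R t" for t
  have "\<exists>l. (q \<longlongrightarrow> l) (at 0)"
  proof (rule mackey_complete_limit_at_0[OF mc d(1)])
    fix f :: "'b \<Rightarrow> real" assume f: "linear f" "continuous_on UNIV f"
    define g where "g x = f (\<Psi> x)" for x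
    have C2: "Ck_power (Suc (Suc 0)) m W g"
      using weak[OF f] unfolding g_def[abs_def] numeral_2_eq_2 .
    define D where "D t = dir_deriv g (x + t *\<^sub>R v) v" for t
    \<comment> \<open>The derivative of \<open>g\<close> along the line is the tangent map of \<open>g\<close> along a line in direction \<open>(v, 0)\<close>.\<close>
    define z where "z t = join_halves m x v + t *\<^sub>R join_halves m v 0" for t :: real
    have z: "z t = join_halves m (x + t *\<^sub>R v) v" for t
      by (auto simp: z_def join_halves_def fun_eq_iff)
    have D: "D t = tangent_map m g (z t)" for t
      by (simp add: D_def z tangent_map_def fst_half_join[OF xP])
    have zdom: "z t \<in> tangent_dom m W" if "\<bar>t\<bar> \<le> d" for t
      using d(2)[OF that] v by (simp add: z tangent_dom_def fst_half_join[OF xP] join_halves_power_space)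
    have "continuous_on {-d..d} z"
      unfolding z_def[abs_def] continuous_on_def
      using tendsto_mono[OF at_within_le_nhds tendsto_line] by blast
    then have contD: "continuous_on {-d..d} D"
      unfolding D[abs_def] using C2 zdom
      by (intro continuous_on_compose2[of "tangent_dom m W" "tangent_map m g" "{-d..d}" z]) auto
    have "z 0 \<in> tangent_dom m W" using zdom[of 0] d(1) by simp
    moreover have "join_halves m v 0 \<in> power_space (2 * m)"
      by (rule join_halves_power_space) (simp add: power_space_def)
    ultimately obtain l where "has_dir_deriv (tangent_map m g) l (z 0) (join_halves m v 0)"
      using C2 unfolding Ck_power.simps by blast
    then have "((\<lambda>t. (D t - D 0) /\<^sub>R t) \<longlongrightarrow> l) (at 0)"
      by (simp add: has_dir_deriv_def D z_def)
    then obtain M where M: "\<And>t. \<bar>t\<bar> \<le> d \<Longrightarrow> \<bar>D t - D 0\<bar> \<le> M * \<bar>t\<bar>"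
      using difference_quotient_bounded[OF contD] by blast
    have M0: "0 \<le> M" using order_trans[OF abs_ge_zero M[of d]] d(1) by (simp add: zero_le_mult_iff)
    have near: "\<bar>f (q t) - D 0\<bar> \<le> M * \<bar>t\<bar>" if t: "t \<noteq> 0" "\<bar>t\<bar> \<le> d" for t
    proof -
      have "((\<lambda>r. g (x + r *\<^sub>R v)) has_real_derivative D s) (at s)" if s: "\<bar>s\<bar> \<le> \<bar>t\<bar>" for s
      proof (rule has_real_derivative_along_line[where f = g])
        obtain l where "has_dir_deriv g l (x + s *\<^sub>R v) v"
          using C2 d(2)[of s] s t(2) v unfolding Ck_power.simps by (meson order_trans)
        then show "has_dir_deriv g (D s) (x + s *\<^sub>R v) v" by (simp add: D_def dir_deriv_eq)
      qed
      then obtain s where s: "\<bar>s\<bar> \<le> \<bar>t\<bar>" "g (x + t *\<^sub>R v) - g (x + 0 *\<^sub>R v) = t * D s"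
        by (rule mvt_from_zero)
      have "f (q t) = D s"
        using s(2) t(1) by (simp add: q_def g_def linear_scale[OF f(1)] linear_diff[OF f(1)])
      then have "\<bar>f (q t) - D 0\<bar> \<le> M * \<bar>s\<bar>" using M[of s] s(1) t(2) by simp
      also have "\<dots> \<le> M * \<bar>t\<bar>" using s(1) M0 by (rule mult_left_mono)
      finally show ?thesis .
    qed
    show "\<exists>M. \<forall>s t. s \<noteq> 0 \<longrightarrow> \<bar>s\<bar> \<le> d \<longrightarrow> t \<noteq> 0 \<longrightarrow> \<bar>t\<bar> \<le> d \<longrightarrow> \<bar>f (q s - q t)\<bar> \<le> M * (\<bar>s\<bar> + \<bar>t\<bar>)"
    proof (intro exI[of _ M] allI impI)
      fix s t assume "s \<noteq> 0" "\<bar>s\<bar> \<le> d" "t \<noteq> 0" "\<bar>t\<bar> \<le> d"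
      with near[of s] near[of t] show "\<bar>f (q s - q t)\<bar> \<le> M * (\<bar>s\<bar> + \<bar>t\<bar>)"
        by (simp add: linear_diff[OF f(1)] distrib_left)
    qed
  qed blast
  then show ?thesis by (simp add: has_dir_deriv_def q_def[abs_def])
qed

text \<open>This is where the assumption on the \<open>c\<^sup>\<infinity>\<close>-topology enters: continuity has to be
  tested only along smooth curves \<open>c\<close>. By the chain rule, the difference quotients of
  \<open>\<Psi> \<circ> c\<close> at a point are weakly bounded, hence bounded, and so the increments
  \<open>\<Psi> (c (t0 + t)) - \<Psi> (c t0)\<close>, being \<open>t\<close> times elements of a bounded set, tend to \<open>0\<close>.\<close>

lemma weakly_C1_continuous:
  fixes \<Psi> :: "(nat \<Rightarrow> 'a::locally_convex_space) \<Rightarrow> 'b::locally_convex_space"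
  assumes top: "c_infinity_topology (power_space m :: (nat \<Rightarrow> 'a) set) = top_of_set (power_space m)"
    and W: "openin (top_of_set (power_space m)) W"
    and weak: "\<And>f :: 'b \<Rightarrow> real. linear f \<Longrightarrow> continuous_on UNIV f \<Longrightarrow> Ck_power 1 m W (\<lambda>x. f (\<Psi> x))"
  shows "continuous_on W \<Psi>"
  unfolding continuous_openin_preimage_eq
proof (intro allI impI)
  fix N :: "'b set" assume N: "open N"
  obtain G where G: "open G" "W = power_space m \<inter> G" using W by (auto simp: openin_open)
  have "open (c -` (W \<inter> \<Psi> -` N))" if c: "c \<in> smooth_curves_in (power_space m)" for c
    unfolding open_dist
  proof
    fix t0 assume t0: "t0 \<in> c -` (W \<inter> \<Psi> -` N)"
    have "Ck_on (Suc 0) UNIV c" and cP: "\<And>t. c t \<in> power_space m"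
      using c by (auto simp: smooth_curves_in_def smooth_on_def)
    then have C1: "C1_on UNIV c" by (simp only: Ck_on_Suc)
    then have ccont: "continuous_on UNIV c" by (simp add: C1_on_def)
    obtain w where w: "has_dir_deriv c w t0 1" using C1 by (auto simp: C1_on_def)
    have wP: "w \<in> power_space m"
      using dir_deriv_in_closed_subspace[OF closed_power_space subspace_power_space _ w, of m] cP by auto
    define u where "u t = (c (t0 + t) - c t0) /\<^sub>R t" for t
    have u: "(u \<longlongrightarrow> w) (at 0)" using w by (simp add: has_dir_deriv_def u_def[abs_def])
    have uP: "u t \<in> power_space m" for t
      unfolding u_def by (intro subspace_scale subspace_diff subspace_power_space cP)
    have "open (c -` G)" by (rule open_vimage[OF G(1) ccont])
    then obtain e where e: "e > 0" "\<And>t. dist t t0 < e \<Longrightarrow> t \<in> c -` G"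
      using t0 G(2) by (auto simp: open_dist)
    define d where "d = e / 2"
    have d0: "0 < d" using e(1) by (simp add: d_def)
    have d: "c (t0 + t) \<in> W" if "\<bar>t\<bar> \<le> d" for t
    proof -
      have "t0 + t \<in> c -` G" using that e(1) by (intro e(2)) (simp add: d_def dist_real_def)
      then show "c (t0 + t) \<in> W" using cP G(2) by simp
    qed
    have cW: "c t0 \<in> W" using d[of 0] d0 by simp
    define A where "A = (\<lambda>t. (\<Psi> (c (t0 + t)) - \<Psi> (c t0)) /\<^sub>R t) ` {t. t \<noteq> 0 \<and> \<bar>t\<bar> \<le> d}"
    have bdd: "tvs_bounded A"
    proof (rule weakly_bounded_imp_bounded)
      fix f :: "'b \<Rightarrow> real" assume f: "linear f" "continuous_on UNIV f"
      define h where "h t = f (\<Psi> (c (t0 + t)))" for t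
      have C1f: "Ck_power (Suc 0) m W (\<lambda>x. f (\<Psi> x))" using weak[OF f] by simp
      have ex: "\<exists>l. has_dir_deriv (\<lambda>x. f (\<Psi> x)) l x v" if "x \<in> W" "v \<in> power_space m" for x v
        using C1f that unfolding Ck_power.simps by blast
      have "continuous_on (W \<times> power_space m) (\<lambda>(x, v). dir_deriv (\<lambda>x. f (\<Psi> x)) x v)"
        using C1f openin_imp_subset[OF W] by (intro continuous_on_dir_deriv_pair) auto
      then have "((\<lambda>t. (f (\<Psi> (c t0 + t *\<^sub>R u t)) - f (\<Psi> (c t0))) /\<^sub>R t) \<longlongrightarrow> dir_deriv (\<lambda>x. f (\<Psi> x)) (c t0) w) (at 0)"
        by (intro dir_deriv_along_curve[OF subspace_power_space W ex] cW u wP always_eventually allI uP)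
      then have lim: "((\<lambda>t. (h t - h 0) /\<^sub>R t) \<longlongrightarrow> dir_deriv (\<lambda>x. f (\<Psi> x)) (c t0) w) (at 0)"
      proof (rule Lim_transform_eventually)
        have step: "c t0 + t *\<^sub>R u t = c (t0 + t)" if "t \<noteq> 0" for t
          unfolding u_def scaleR_scaleR right_inverse[OF that] scaleR_one by (metis add.commute diff_add_cancel)
        have "(f (\<Psi> (c t0 + t *\<^sub>R u t)) - f (\<Psi> (c t0))) /\<^sub>R t = (h t - h 0) /\<^sub>R t" if "t \<noteq> 0" for t
          unfolding step[OF that] h_def add_0_right ..
        then show "\<forall>\<^sub>F t in at 0. (f (\<Psi> (c t0 + t *\<^sub>R u t)) - f (\<Psi> (c t0))) /\<^sub>R t = (h t - h 0) /\<^sub>R t"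
          unfolding eventually_at_filter by (intro always_eventually allI impI)
      qed
      have "continuous_on {-d..d} (\<lambda>t. c (t0 + t))"
        by (rule continuous_on_compose2[OF ccont]) (auto intro!: continuous_intros)
      then have "continuous_on {-d..d} h"
        unfolding h_def
        by (rule continuous_on_compose2[of W "\<lambda>x. f (\<Psi> x)", rotated])
           (use C1f d in auto)
      then obtain M where M: "\<And>t. \<bar>t\<bar> \<le> d \<Longrightarrow> \<bar>h t - h 0\<bar> \<le> M * \<bar>t\<bar>"
        using difference_quotient_bounded[OF _ lim] by blast
      show "\<exists>b. \<forall>x\<in>A. \<bar>f x\<bar> \<le> b"
      proof (intro exI[of _ M] ballI)
        fix a assume "a \<in> A"
        then obtain t where t: "t \<noteq> 0" "\<bar>t\<bar> \<le> d" "a = (\<Psi> (c (t0 + t)) - \<Psi> (c t0)) /\<^sub>R t"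
          by (auto simp: A_def)
        have "f a = (h t - h 0) / t"
          by (simp add: t(3) linear_scale[OF f(1)] linear_diff[OF f(1)] h_def divide_inverse_commute)
        then show "\<bar>f a\<bar> \<le> M" using M[OF t(2)] t(1) by (simp add: abs_divide divide_le_eq)
      qed
    qed
    have "open ((\<lambda>y. \<Psi> (c t0) + y) -` N)"
      by (rule open_vimage[OF N]) (intro continuous_intros)
    moreover have "0 \<in> (\<lambda>y. \<Psi> (c t0) + y) -` N" using t0 by simp
    ultimately obtain r where r: "0 < r"
      "\<And>t a. \<bar>t\<bar> < r \<Longrightarrow> a \<in> A \<Longrightarrow> t *\<^sub>R a \<in> (\<lambda>y. \<Psi> (c t0) + y) -` N"
      using tvs_bounded_small_multiples[OF bdd] by blast
    show "\<exists>e>0. \<forall>t. dist t t0 < e \<longrightarrow> t \<in> c -` (W \<inter> \<Psi> -` N)"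
    proof (intro exI[of _ "min d r"] conjI allI impI)
      fix t assume "dist t t0 < min d r"
      then have t: "\<bar>t - t0\<bar> \<le> d" "\<bar>t - t0\<bar> < r" by (auto simp: dist_real_def)
      have "\<Psi> (c t) \<in> N"
      proof (cases "t = t0")
        case False
        then have "(\<Psi> (c t) - \<Psi> (c t0)) /\<^sub>R (t - t0) \<in> A"
          using t(1) unfolding A_def by (intro image_eqI[of _ _ "t - t0"]) auto
        from r(2)[OF t(2) this] show ?thesis using False by simp
      qed (use t0 in simp)
      then show "t \<in> c -` (W \<inter> \<Psi> -` N)" using d[OF t(1)] by simp
    qed (use d0 r(1) in simp)
  qed
  then have "openin (top_of_set (power_space m)) (W \<inter> \<Psi> -` N)"
    unfolding top[symmetric] openin_c_infinity_topology using openin_imp_subset[OF W] by blast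
  then show "openin (top_of_set W) (W \<inter> \<Psi> -` N)"
    by (rule openin_subset_trans) (use openin_imp_subset[OF W] in auto)
qed

text \<open>The tangent map of \<open>\<Psi>\<close> exists, and a continuous linear \<open>f\<close> commutes with forming tangent maps;
  so the tangent map is itself weakly smooth, now on \<open>E\<^sup>2\<^sup>m\<close>. As the assumption on the
  \<open>c\<^sup>\<infinity>\<close>-topology concerns all powers of \<open>E\<close>, the argument can be repeated.\<close>

theorem weakly_smooth_imp_Ck_power:
  fixes \<Psi> :: "(nat \<Rightarrow> 'a::locally_convex_space) \<Rightarrow> 'b::locally_convex_space"
  assumes mc: "mackey_complete TYPE('b)"
    and top: "\<And>n. 1 \<le> n \<Longrightarrow> c_infinity_topology (power_space n :: (nat \<Rightarrow> 'a) set) = top_of_set (power_space n)"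
    and "1 \<le> m" "openin (top_of_set (power_space m)) W"
    and "\<And>(f :: 'b \<Rightarrow> real) j. linear f \<Longrightarrow> continuous_on UNIV f \<Longrightarrow> Ck_power j m W (\<lambda>x. f (\<Psi> x))"
  shows "Ck_power k m W \<Psi>"
  using assms(3-5)
proof (induction k arbitrary: m W \<Psi>)
  case 0
  show ?case
    unfolding Ck_power.simps(1)
    by (rule weakly_C1_continuous[OF top[OF 0(1)] 0(2,3)])
next
  case (Suc k)
  note W = Suc.prems(2) and weak = Suc.prems(3)
  have ex: "\<exists>l. has_dir_deriv \<Psi> l x v" if "x \<in> W" "v \<in> power_space m" for x v
    by (rule weakly_C2_has_dir_deriv[OF mc W weak that])
  have "Ck_power j (2 * m) (tangent_dom m W) (\<lambda>z. f (tangent_map m \<Psi> z))"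
    if f: "linear f" "continuous_on UNIV f" for f :: "'b \<Rightarrow> real" and j
  proof -
    have eq: "f (tangent_map m \<Psi> z) = tangent_map m (\<lambda>x. f (\<Psi> x)) z" if "z \<in> tangent_dom m W" for z
    proof -
      have "fst_half m z \<in> W" "snd_half m z \<in> power_space m"
        using that snd_half_power_space by (auto simp: tangent_dom_def)
      then obtain l where l: "has_dir_deriv \<Psi> l (fst_half m z) (snd_half m z)" using ex by blast
      have "has_dir_deriv (\<lambda>x. f (\<Psi> x)) (f l) (fst_half m z) (snd_half m z)"
        using continuous_on_tendsto_compose[OF f(2) l[unfolded has_dir_deriv_def]]
        by (simp add: has_dir_deriv_def linear_scale[OF f(1)] linear_diff[OF f(1)])
      then show ?thesis by (simp add: tangent_map_def dir_deriv_eq[OF l] dir_deriv_eq)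
    qed
    have "Ck_power j (2 * m) (tangent_dom m W) (tangent_map m (\<lambda>x. f (\<Psi> x)))"
      using weak[OF f, of "Suc j"] by simp
    then show ?thesis by (subst Ck_power_cong[OF openin_tangent_dom[OF W] eq])
  qed
  then have "Ck_power k (2 * m) (tangent_dom m W) (tangent_map m \<Psi>)"
    using Suc.prems(1) by (intro Suc.IH openin_tangent_dom[OF W]) auto
  moreover have "continuous_on W \<Psi>"
    by (rule weakly_C1_continuous[OF top[OF Suc.prems(1)] W weak])
  ultimately show ?case using ex Ck_power_continuous by auto
qed

section \<open>Equivalence of the notions of smoothness\<close>

lemma openin_first_coordinate:
  fixes U :: "'a::{zero,topological_space} set"
  assumes "open U"
  shows "openin (top_of_set (power_space 1)) {x \<in> power_space 1. x 0 \<in> U}"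
  using open_vimage_coordinate[OF assms, of 0] by (auto simp: openin_open)

lemma smooth_on_compose_real:
  fixes f :: "'b::locally_convex_space \<Rightarrow> real" and \<Phi> :: "'a::locally_convex_space \<Rightarrow> 'b"
  assumes "open U" "open V" "\<Phi> ` U \<subseteq> V" "smooth_on U \<Phi>" "smooth_on V f"
  shows "smooth_on U (f \<circ> \<Phi>)"
  unfolding smooth_on_def Ck_on_def
proof
  fix k
  let ?U = "{x \<in> power_space 1. x 0 \<in> U} :: (nat \<Rightarrow> 'a) set"
  let ?V = "{x \<in> power_space 1. x 0 \<in> V} :: (nat \<Rightarrow> 'b) set"
  define \<Psi> :: "(nat \<Rightarrow> 'a) \<Rightarrow> nat \<Rightarrow> 'b" where "\<Psi> x = (\<lambda>i. if i = 0 then \<Phi> (x 0) else 0)" for x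
  have "Ck_power k 1 ?U (\<lambda>x. f (\<Psi> x 0))"
  proof (rule Ck_power_compose[where f = "\<lambda>y. f (y 0)" and \<Phi> = \<Psi>, OF openin_first_coordinate openin_first_coordinate])
    show "\<Psi> ` ?U \<subseteq> ?V" using assms(3) by (auto simp: \<Psi>_def power_space_def)
    show "Ck_power k 1 ?V (\<lambda>y. f (y 0))" using assms(5) by (simp add: smooth_on_def Ck_on_def)
    have "Ck_power k 1 ?U (\<lambda>x. 0 :: 'b)"
      by (rule Ck_power_linear) (auto intro: linearI)
    then show "Ck_power k 1 ?U (\<lambda>x. \<Psi> x i)" for i
      using assms(4) by (cases "i = 0") (auto simp: \<Psi>_def smooth_on_def Ck_on_def)
  qed (use assms in auto)
  then show "Ck_power k 1 ?U (\<lambda>x. (f \<circ> \<Phi>) (x 0))" by (simp add: \<Psi>_def)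
qed

lemma smooth_on_linear:
  fixes L :: "'a::locally_convex_space \<Rightarrow> 'b::locally_convex_space"
  assumes "linear L" "continuous_on UNIV L"
  shows "smooth_on S L"
  unfolding smooth_on_def Ck_on_def
proof
  fix k
  show "Ck_power k 1 {x \<in> power_space 1. x 0 \<in> S} (\<lambda>x. L (x 0))"
  proof (rule Ck_power_linear)
    show "linear (\<lambda>x::nat \<Rightarrow> 'a. L (x 0))"
      by (rule linearI) (auto simp: linear_add[OF assms(1)] linear_scale[OF assms(1)])
    show "continuous_on UNIV (\<lambda>x::nat \<Rightarrow> 'a. L (x 0))"
      by (rule continuous_on_compose2[OF assms(2) continuous_on_coord[OF continuous_on_id]]) simp
  qed
qed

theorem weakly_smooth_imp_smooth:
  fixes \<Phi> :: "'a::locally_convex_space \<Rightarrow> 'b::locally_convex_space"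
  assumes "open U"
    and "\<And>n. 1 \<le> n \<Longrightarrow> c_infinity_topology (power_space n :: (nat \<Rightarrow> 'a) set) = top_of_set (power_space n)"
    and "mackey_complete TYPE('b)"
    and "\<And>l :: 'b \<Rightarrow> real. linear l \<Longrightarrow> continuous_on UNIV l \<Longrightarrow> smooth_on U (l \<circ> \<Phi>)"
  shows "smooth_on U \<Phi>"
  unfolding smooth_on_def Ck_on_def
proof
  fix k
  show "Ck_power k 1 {x \<in> power_space 1. x 0 \<in> U} (\<lambda>x. \<Phi> (x 0))"
  proof (rule weakly_smooth_imp_Ck_power[OF assms(3,2) _ openin_first_coordinate[OF assms(1)]])
    fix f :: "'b \<Rightarrow> real" and j assume "linear f" "continuous_on UNIV f"
    from assms(4)[OF this] show "Ck_power j 1 {x \<in> power_space 1. x 0 \<in> U} (\<lambda>x. f (\<Phi> (x 0)))"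
      by (simp add: smooth_on_def Ck_on_def)
  qed simp_all
qed

theorem theoremA:
  fixes U :: "'a::locally_convex_space set"
    and \<Phi> :: "'a \<Rightarrow> 'b::locally_convex_space"
  assumes "open U"
    and "\<forall>n\<ge>1. c_infinity_topology (power_space n :: (nat \<Rightarrow> 'a) set) = top_of_set (power_space n)"
    and "mackey_complete TYPE('b)"
    and "continuous_on U \<Phi>"
  shows "(smooth_on U \<Phi> \<longleftrightarrow>
            (\<forall>V (f :: 'b \<Rightarrow> real). open V \<and> \<Phi> ` U \<subseteq> V \<and> smooth_on V f \<longrightarrow> smooth_on U (f \<circ> \<Phi>))) \<and>
         (smooth_on U \<Phi> \<longleftrightarrow>
            (\<forall>f :: 'b \<Rightarrow> real. smooth_on UNIV f \<longrightarrow> smooth_on U (f \<circ> \<Phi>))) \<and>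
         (smooth_on U \<Phi> \<longleftrightarrow>
            (\<forall>l :: 'b \<Rightarrow> real. linear l \<and> continuous_on UNIV l \<longrightarrow> smooth_on U (l \<circ> \<Phi>)))"
    (is "(?i \<longleftrightarrow> ?ii) \<and> (?i \<longleftrightarrow> ?iii) \<and> (?i \<longleftrightarrow> ?iv)")
proof -
  have "?i \<Longrightarrow> ?ii" using smooth_on_compose_real[OF assms(1)] by blast
  moreover have "?ii \<Longrightarrow> ?iii" by blast
  moreover have "?iii \<Longrightarrow> ?iv" using smooth_on_linear by blast
  moreover have "?iv \<Longrightarrow> ?i" using weakly_smooth_imp_smooth[OF assms(1) _ assms(3)] assms(2) by blast
  ultimately show ?thesis by blast
qed

end
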